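(* Let $\sigma_B$ be a catalyst and let $\Psi_1$ and $\Psi_2$ be unital maps acting on $A_1$ and $A_2$ respectively. Let $\Psi$ be any quantum map on $A_1A_2$ that is implemented catalytically utilizing $\sigma_B$ and satisfies $\mathrm{Tr}_{A_2}\circ\Psi=\Psi_1\circ\mathrm{Tr}_{A_2}$ and $\mathrm{Tr}_{A_1}\circ\Psi=\Psi_2\circ\mathrm{Tr}_{A_1}$. Then $$\max_{\rho_1,\rho_2}I(A_1:A_2)_{\Psi(\rho_1\otimes\rho_2)}\ \ge\ S(\Psi_1)+S(\Psi_2)-S^\diamond(\sigma),$$ where the maximum is over states $\rho_1$ on $A_1$ and $\rho_2$ on $A_2$.
   Context: All systems are finite-dimensional. $S(\rho)=-\mathrm{Tr}[\rho\log_2\rho]$ for states, and $I(X:Y)=S(X)+S(Y)-S(XY)$. For a quantum map $\Phi$, $S(\Phi)=\max_\rho[S(\Phi(\rho))-S(\rho)]$ is its maximal local entropy production. A quantum map is completely positive and trace-preserving; it is unital if it preserves the maximally mixed state. A quantum map $\Phi$ on $A$ is implemented catalytically with the catalyst $\sigma_B$ (a state on $B$) if there are a unitary $U$ on $AB$ and a unitary $V$ on $B$ with $\mathrm{Tr}_B\,U(\rho_A\otimes\sigma_B)U^\dagger=\Phi(\rho)$ and $\mathrm{Tr}_A\,U(\rho_A\otimes\sigma_B)U^\dagger=V\sigma_BV^\dagger$ for all states $\rho$ on $A$ (here $A=A_1A_2$). For $\sigma=\sum_i\lambda_i\Pi_i$ with distinct eigenvalues $\lambda_i$ and eigenspace projectors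 $\Pi_i$ of rank $r_i$, the catalytic entropy is $S^\diamond(\sigma)=-\sum_i\lambda_ir_i\log_2(\lambda_i/r_i)$. *)

theory Defs
  imports "HOL-Analysis.Analysis"
begin

text \<open>
  A system is a finite index type: operators on the system \<open>'n\<close> are the matrices
  \<open>complex^'n^'n\<close>, and a composite system is the product type.
\<close>

type_synonym 'n op = "complex^'n^'n"

definition cinner :: "complex^'n \<Rightarrow> complex^'n \<Rightarrow> complex" where
  "cinner v w = (\<Sum>i\<in>UNIV. cnj (v $ i) * w $ i)"

definition dagger :: "('n::finite) op \<Rightarrow> 'n op" where
  "dagger A = map_matrix cnj (transpose A)"

definition hermitian :: "('n::finite) op \<Rightarrow> bool" where
  "hermitian A \<longleftrightarrow> dagger A = A"

definition unitary :: "('n::finite) op \<Rightarrow> bool" where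
  "unitary U \<longleftrightarrow> U ** dagger U = mat 1 \<and> dagger U ** U = mat 1"

definition psd :: "('n::finite) op \<Rightarrow> bool" where
  "psd A \<longleftrightarrow> (\<forall>v. cinner v (A *v v) \<in> \<real>\<^sub>\<ge>\<^sub>0)"

definition state :: "('n::finite) op \<Rightarrow> bool" where
  "state \<rho> \<longleftrightarrow> psd \<rho> \<and> trace \<rho> = 1"

definition maximally_mixed :: "('n::finite) op" where
  "maximally_mixed = (1 / real CARD('n)) *\<^sub>R mat 1"

definition tensor :: "('a::finite) op \<Rightarrow> ('b::finite) op \<Rightarrow> ('a \<times> 'b) op" where
  "tensor X Y = (\<chi> p q. X $ fst p $ fst q * Y $ snd p $ snd q)"

definition trace_fst :: "('a::finite \<times> 'b::finite) op \<Rightarrow> 'b op" where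
  "trace_fst X = (\<chi> i j. \<Sum>k\<in>UNIV. X $ (k, i) $ (k, j))"

definition trace_snd :: "('a::finite \<times> 'b::finite) op \<Rightarrow> 'a op" where
  "trace_snd X = (\<chi> i j. \<Sum>k\<in>UNIV. X $ (i, k) $ (j, k))"


text \<open>
  Spectral notions. They are only used for hermitian matrices, so it suffices to consider
  real eigenvalues.
\<close>

definition eigenspace :: "('n::finite) op \<Rightarrow> real \<Rightarrow> (complex^'n) set" where
  "eigenspace A l = {v. A *v v = complex_of_real l *s v}"

definition eigenvalues :: "('n::finite) op \<Rightarrow> real set" where
  "eigenvalues A = {l. \<exists>v. v \<noteq> 0 \<and> v \<in> eigenspace A l}"

definition eigenprojector :: "('n::finite) op \<Rightarrow> real \<Rightarrow> 'n op" where
  "eigenprojector A l =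
     (THE P. hermitian P \<and> P ** P = P \<and> range (\<lambda>v. P *v v) = eigenspace A l)"

definition matrix_fun :: "(real \<Rightarrow> real) \<Rightarrow> ('n::finite) op \<Rightarrow> 'n op" where
  "matrix_fun f A = (\<Sum>l\<in>eigenvalues A. f l *\<^sub>R eigenprojector A l)"

text \<open>
  Since \<open>log 2 0 = 0\<close> in HOL, the kernel of the state does not contribute to the entropies
  below, in accordance with the convention \<open>0 log 0 = 0\<close>.
\<close>

definition entropy :: "('n::finite) op \<Rightarrow> real" where
  "entropy \<rho> = - Re (trace (\<rho> ** matrix_fun (log 2) \<rho>))"

definition mutual_information :: "('a::finite \<times> 'b::finite) op \<Rightarrow> real" where
  "mutual_information \<rho> = entropy (trace_snd \<rho>) + entropy (trace_fst \<rho>) - entropy \<rho>"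

definition catalytic_entropy :: "('n::finite) op \<Rightarrow> real" where
  "catalytic_entropy \<sigma> = - (\<Sum>l\<in>eigenvalues \<sigma>.
     let r = real (rank (eigenprojector \<sigma> l)) in l * r * log 2 (l / r))"


definition complex_linear :: "(('a::finite) op \<Rightarrow> ('b::finite) op) \<Rightarrow> bool" where
  "complex_linear \<Phi> \<longleftrightarrow>
     (\<forall>X Y. \<Phi> (X + Y) = \<Phi> X + \<Phi> Y) \<and>
     (\<forall>c X. \<Phi> (map_matrix ((*) c) X) = map_matrix ((*) c) (\<Phi> X))"

text \<open>
  An operator on \<open>\<complex>\<^sup>k \<otimes> \<complex>\<^sup>n\<close> is given by its \<open>k \<times> k\<close> array \<open>X i j\<close> (\<open>i, j < k\<close>) of blocks,
  which are operators on \<open>\<complex>\<^sup>n\<close>; a vector of \<open>\<complex>\<^sup>k \<otimes> \<complex>\<^sup>n\<close> is given by its components \<open>v i\<close>.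
  The map \<open>id\<^sub>k \<otimes> \<Phi>\<close> applies \<open>\<Phi>\<close> to every block, and complete positivity is positivity of
  \<open>id\<^sub>k \<otimes> \<Phi>\<close> for every \<open>k\<close>.
\<close>

definition block_psd :: "nat \<Rightarrow> (nat \<Rightarrow> nat \<Rightarrow> ('n::finite) op) \<Rightarrow> bool" where
  "block_psd k X \<longleftrightarrow>
     (\<forall>v :: nat \<Rightarrow> complex^'n. (\<Sum>i<k. \<Sum>j<k. cinner (v i) (X i j *v v j)) \<in> \<real>\<^sub>\<ge>\<^sub>0)"

definition completely_positive :: "(('a::finite) op \<Rightarrow> ('b::finite) op) \<Rightarrow> bool" where
  "completely_positive \<Phi> \<longleftrightarrow>
     (\<forall>k X. block_psd k X \<longrightarrow> block_psd k (\<lambda>i j. \<Phi> (X i j)))"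

definition trace_preserving :: "(('a::finite) op \<Rightarrow> ('b::finite) op) \<Rightarrow> bool" where
  "trace_preserving \<Phi> \<longleftrightarrow> (\<forall>X. trace (\<Phi> X) = trace X)"

definition quantum_map :: "(('a::finite) op \<Rightarrow> ('b::finite) op) \<Rightarrow> bool" where
  "quantum_map \<Phi> \<longleftrightarrow> complex_linear \<Phi> \<and> completely_positive \<Phi> \<and> trace_preserving \<Phi>"

definition unital_map :: "(('n::finite) op \<Rightarrow> 'n op) \<Rightarrow> bool" where
  "unital_map \<Phi> \<longleftrightarrow> quantum_map \<Phi> \<and> \<Phi> maximally_mixed = maximally_mixed"

definition implemented_catalytically ::
    "(('a::finite) op \<Rightarrow> 'a op) \<Rightarrow> ('b::finite) op \<Rightarrow> bool" where
  "implemented_catalytically \<Phi> \<sigma> \<longleftrightarrow>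
     (\<exists>(U :: ('a \<times> 'b) op) (V :: 'b op). unitary U \<and> unitary V \<and>
        (\<forall>\<rho>. state \<rho> \<longrightarrow>
           trace_snd (U ** tensor \<rho> \<sigma> ** dagger U) = \<Phi> \<rho> \<and>
           trace_fst (U ** tensor \<rho> \<sigma> ** dagger U) = V ** \<sigma> ** dagger V))"

text \<open>
  \<open>GREATEST\<close> (rather than a supremum) renders a maximum: it is characterised only if the
  maximum is attained.
\<close>

definition entropy_production :: "(('a::finite) op \<Rightarrow> ('b::finite) op) \<Rightarrow> real" where
  "entropy_production \<Phi> = (GREATEST s. \<exists>\<rho>. state \<rho> \<and> s = entropy (\<Phi> \<rho>) - entropy \<rho>)"

definition max_product_correlation ::
    "(('a::finite \<times> 'b::finite) op \<Rightarrow> ('a \<times> 'b) op) \<Rightarrow> real" where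
  "max_product_correlation \<Psi> = (GREATEST s. \<exists>\<rho>1 \<rho>2.
     state \<rho>1 \<and> state \<rho>2 \<and> s = mutual_information (\<Psi> (tensor \<rho>1 \<rho>2)))"

end

theory Submission
  imports Defs "HOL-Real_Asymp.Real_Asymp"
begin

text \<open>
  The catalyst bounds the entropy production: \<open>S(\<Phi>(\<rho>)) \<le> S(\<rho>) + S\<^sup>\<diamond>(\<sigma>)\<close> for every \<open>\<Phi>\<close>
  implemented with \<open>\<sigma>\<close>. Feed the maximally mixed state into \<open>U\<close>: as \<open>\<sigma>\<close> is recovered up to \<open>V\<close>, the equality
  case of Cauchy--Schwarz shows that \<open>U\<close> (composed with the inverse of \<open>V\<close>) commutes with
  \<open>1 \<otimes> \<sigma>\<close>, so that it preserves the eigenspaces of \<open>\<sigma>\<close>. With \<open>\<rho> = \<Sum>\<^sub>k p\<^sub>k |k\<rangle>\<langle>k|\<close> and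
  \<open>\<sigma> = \<Sum>\<^sub>m s\<^sub>m |m\<rangle>\<langle>m|\<close>, the output is a sum of the rank one operators given by the vectors
  \<open>\<surd>(p\<^sub>k s\<^sub>m) \<langle>n|U|k m\<rangle>\<close> with \<open>s\<^sub>n = s\<^sub>m\<close>, and Gibbs' inequality against the distribution
  \<open>p\<^sub>k s\<^sub>m / r\<^sub>m\<close> of \<open>(k, m, n)\<close>, where \<open>r\<^sub>m\<close> is the multiplicity of \<open>s\<^sub>m\<close>, gives the bound.
  For \<open>\<Psi>\<close> it is applied to \<open>\<rho>\<^sub>1 \<otimes> \<rho>\<^sub>2\<close> with \<open>\<rho>\<^sub>i\<close> maximising the entropy production of \<open>\<Psi>\<^sub>i\<close>. The
  maxima exist since states form a compact set on which the entropy is continuous.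
\<close>

section \<open>Spectral theorem\<close>

lemma dagger_nth [simp]: "dagger A $ i $ j = cnj (A $ j $ i)"
  by (simp add: dagger_def map_matrix_def transpose_def)

lemma dagger_dagger [simp]: "dagger (dagger A) = A"
  by (simp add: vec_eq_iff)

lemma dagger_mul: "dagger (A ** B) = dagger B ** dagger A"
  by (simp add: vec_eq_iff matrix_matrix_mult_def mult.commute)

lemma dagger_mat_1 [simp]: "dagger (mat 1) = mat 1"
  by (simp add: vec_eq_iff mat_def)

lemma unitary_dagger: "unitary U \<Longrightarrow> unitary (dagger U)"
  by (simp add: unitary_def)

lemma unitary_mul: "unitary U \<Longrightarrow> unitary V \<Longrightarrow> unitary (U ** V)"
  unfolding unitary_def dagger_mul
  by (metis matrix_mul_assoc matrix_mul_lid)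

section \<open>The complex inner product and adjoints\<close>

lemma cinner_cnj: "cnj (cinner v w) = cinner w v"
  by (simp add: cinner_def mult.commute)

lemma cinner_add_right: "cinner u (v + w) = cinner u v + cinner u w"
  by (simp add: cinner_def distrib_left sum.distrib)

lemma cinner_add_left: "cinner (u + v) w = cinner u w + cinner v w"
  by (simp add: cinner_def distrib_right sum.distrib)

lemma cinner_scale_right: "cinner u (c *s v) = c * cinner u v"
  by (simp add: cinner_def sum_distrib_left mult_ac)

lemma cinner_scale_left: "cinner (c *s u) v = cnj c * cinner u v"
  by (simp add: cinner_def sum_distrib_left mult_ac)

lemma cinner_adjoint: "cinner v (A *v w) = cinner (dagger A *v v) w"
proof -
  have "cinner v (A *v w) = (\<Sum>i\<in>UNIV. \<Sum>j\<in>UNIV. cnj (v $ i) * A $ i $ j * w $ j)"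
    by (simp add: cinner_def matrix_vector_mult_def sum_distrib_left mult_ac)
  also have "\<dots> = (\<Sum>j\<in>UNIV. \<Sum>i\<in>UNIV. cnj (v $ i) * A $ i $ j * w $ j)"
    by (rule sum.swap)
  also have "\<dots> = cinner (dagger A *v v) w"
    by (simp add: cinner_def matrix_vector_mult_def sum_distrib_right sum_distrib_left mult_ac)
  finally show ?thesis .
qed

lemma inner_eq_Re_cinner: "inner v w = Re (cinner v w)"
  by (simp add: inner_vec_def cinner_def inner_complex_def)

lemma cinner_self: "cinner v v = complex_of_real ((norm v)\<^sup>2)"
proof (rule complex_eqI)
  show "Re (cinner v v) = Re (complex_of_real ((norm v)\<^sup>2))"
    by (simp add: inner_eq_Re_cinner[symmetric] dot_square_norm)
  have "cnj (cinner v v) = cinner v v" by (rule cinner_cnj)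
  then show "Im (cinner v v) = Im (complex_of_real ((norm v)\<^sup>2))"
    by (metis Im_complex_of_real Reals_cnj_iff complex_is_Real_iff)
qed

lemma of_real_scale: "complex_of_real c *s v = c *\<^sub>R v"
  unfolding vec_eq_iff by (simp add: scaleR_conv_of_real[where 'a = complex])

lemma matrix_scaleR: "(A :: ('n::finite) op) *v (c *\<^sub>R v) = c *\<^sub>R (A *v v)"
  by (simp add: of_real_scale[symmetric] vector_scalar_commute)

lemma inner_hermitian:
  assumes "hermitian A"
  shows "inner v (A *v w) = inner (A *v v) w"
  using assms by (simp add: inner_eq_Re_cinner cinner_adjoint hermitian_def)

lemma continuous_on_cinner [continuous_intros]:
  assumes "continuous_on S f" "continuous_on S g"
  shows "continuous_on S (\<lambda>x. cinner (f x) (g x))"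
  unfolding cinner_def using assms by (intro continuous_intros)

text \<open>Maximise the Rayleigh quotient over the unit vectors orthogonal to \<open>E\<close>.\<close>

lemma hermitian_extend_eigenvectors:
  fixes A :: "('n::finite) op"
  assumes A: "hermitian A" and E: "finite E" "card E < CARD('n)"
    and eig: "\<And>e. e \<in> E \<Longrightarrow> \<exists>l. A *v e = complex_of_real l *s e"
  shows "\<exists>u l. norm u = 1 \<and> A *v u = complex_of_real l *s u \<and> (\<forall>e\<in>E. cinner e u = 0)"
proof -
  define W where "W = {v. \<forall>e\<in>E. cinner e v = 0}"
  define S where "S = W \<inter> sphere 0 1"
  define f where "f v = inner v (A *v v)" for v
  have Wadd: "v + w \<in> W" if "v \<in> W" "w \<in> W" for v w
    using that by (simp add: W_def cinner_add_right)
  have Wscale: "c *s v \<in> W" if "v \<in> W" for v c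
    using that by (simp add: W_def cinner_scale_right)
  \<comment> \<open>\<open>A\<close> is hermitian and sends each \<open>e\<close> to a multiple of
    itself, so the orthogonal complement of \<open>E\<close> is invariant.\<close>
  have WA: "A *v v \<in> W" if v: "v \<in> W" for v
    unfolding W_def
  proof safe
    fix e assume e: "e \<in> E"
    obtain l where l: "A *v e = complex_of_real l *s e" using eig[OF e] by blast
    have "cinner e (A *v v) = cinner (A *v e) v"
      using A by (simp add: cinner_adjoint hermitian_def)
    also have "\<dots> = 0" using v e by (simp add: l cinner_scale_left W_def)
    finally show "cinner e (A *v v) = 0" .
  qed
  \<comment> \<open>Complex orthogonality to \<open>e\<close> means real orthogonality to both
    \<open>e\<close> and \<open>\<i> *s e\<close>. These are at most \<open>2 * card E\<close>
    vectors, fewer than the real dimension \<open>2 * CARD('n)\<close>, so \<open>W\<close> contains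
    a nonzero \<open>x\<close>.\<close>
  let ?F = "E \<union> (\<lambda>e. \<i> *s e) ` E"
  have "dim ?F \<le> card ?F" using E by (intro dim_le_card) (auto intro: span_base)
  also have "\<dots> \<le> card E + card ((\<lambda>e. \<i> *s e) ` E)" by (rule card_Un_le)
  also have "\<dots> \<le> card E + card E" using E card_image_le by (intro add_left_mono) blast
  also have "\<dots> < DIM(complex^'n)" using E by simp
  finally obtain x where x: "x \<noteq> 0" "\<And>y. y \<in> span ?F \<Longrightarrow> orthogonal x y"
    using orthogonal_to_subspace_exists by blast
  have "cinner e x = 0" if e: "e \<in> E" for e
  proof (rule complex_eqI)
    have "orthogonal x e" "orthogonal x (\<i> *s e)" using e by (auto intro!: x span_base)
    then have "Re (cinner x e) = 0" "Re (\<i> * cinner x e) = 0"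
      by (simp_all add: orthogonal_def inner_eq_Re_cinner cinner_scale_right)
    then show "Re (cinner e x) = Re 0" "Im (cinner e x) = Im 0"
      by (simp_all add: cinner_cnj[of x e, symmetric])
  qed
  then have xW: "x \<in> W" by (simp add: W_def)
  have "complex_of_real (1 / norm x) *s x \<in> S"
    using x Wscale[OF xW, of "complex_of_real (1 / norm x)"]
    by (simp add: S_def of_real_scale del: of_real_divide)
  then have ne: "S \<noteq> {}" by blast
  have "W = (\<Inter>e\<in>E. {v. cinner e v = 0})" by (auto simp: W_def)
  moreover have "closed {v. cinner e v = 0}" for e :: "complex^'n"
    by (intro closed_Collect_eq continuous_intros)
  ultimately have "closed W" by auto
  then have cS: "compact S" unfolding S_def by (simp add: closed_Int_compact)
  have "continuous_on S f"
    unfolding f_def by (intro continuous_intros linear_continuous_on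
        matrix_vector_mul_bounded_linear)
  then obtain u where u: "u \<in> S" and max: "\<And>v. v \<in> S \<Longrightarrow> f v \<le> f u"
    using continuous_attains_sup[OF cS ne] by blast
  have uW: "u \<in> W" and nu: "norm u = 1" using u by (auto simp: S_def)
  have iu: "inner u u = 1" using nu by (simp add: dot_square_norm)
  define l where "l = f u"
  have fscale: "f (c *\<^sub>R v) = c\<^sup>2 * f v" for c v
    by (simp add: f_def matrix_scaleR power2_eq_square)
  have le: "f v \<le> l * (norm v)\<^sup>2" if v: "v \<in> W" for v
  proof (cases "v = 0")
    case True then show ?thesis by (simp add: f_def)
  next
    case False
    have "(1 / norm v) *\<^sub>R v \<in> S"
      using False Wscale[OF v, of "complex_of_real (1 / norm v)"]
      by (simp add: S_def of_real_scale del: of_real_divide)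
    from max[OF this] show ?thesis using False
      by (simp add: fscale l_def field_simps)
  qed
  \<comment> \<open>The residual of the eigenvector equation. It lies in \<open>W\<close>, so
    \<open>u\<close> may be perturbed along it, and maximality of \<open>u\<close> forces it to
    vanish.\<close>
  define w where "w = l *\<^sub>R u - A *v u"
  have "w = complex_of_real l *s u + (-1) *s (A *v u)"
    by (simp add: w_def of_real_scale vec_eq_iff)
  then have wW: "w \<in> W" using Wadd[OF Wscale[OF uW] Wscale[OF WA[OF uW]]] by metis
  define c where "c = l * (norm w)\<^sup>2 - f w"
  have c: "0 \<le> c" using le[OF wW] by (simp add: c_def)
  \<comment> \<open>This is \<open>le\<close> at \<open>u + t *\<^sub>R w\<close>: the constant
    terms cancel, and the linear term is the inner product of \<open>w\<close> with
    \<open>l *\<^sub>R u - A *v u\<close>, which is \<open>w\<close> itself.\<close>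
  have main: "0 \<le> 2 * t * (norm w)\<^sup>2 + t\<^sup>2 * c" for t :: real
  proof -
    have "u + t *\<^sub>R w \<in> W" using Wadd[OF uW Wscale[OF wW, of "complex_of_real t"]]
      by (simp add: of_real_scale)
    note le' = le[OF this]
    have nn: "(norm (u + t *\<^sub>R w))\<^sup>2 = 1 + 2 * t * inner w u + t\<^sup>2 * (norm w)\<^sup>2"
      using iu unfolding power2_norm_eq_inner
      by (simp add: inner_add_left inner_add_right inner_commute power2_eq_square distrib_left)
    have ff: "f (u + t *\<^sub>R w) = l + 2 * t * inner w (A *v u) + t\<^sup>2 * f w"
      using inner_hermitian[OF A, of u w] inner_hermitian[OF A, of w u]
      by (simp add: f_def l_def matrix_vector_right_distrib matrix_scaleR
          inner_add_left inner_add_right inner_commute power2_eq_square distrib_left)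
    have nw: "(norm w)\<^sup>2 = l * inner w u - inner w (A *v u)"
      unfolding power2_norm_eq_inner
      by (subst (2) w_def) (simp add: inner_diff_right inner_commute)
    have "0 \<le> l * (1 + 2 * t * inner w u + t\<^sup>2 * (norm w)\<^sup>2)
        - (l + 2 * t * inner w (A *v u) + t\<^sup>2 * f w)"
      using le' unfolding nn ff by simp
    also have "\<dots> = 2 * t * (l * inner w u - inner w (A *v u)) + t\<^sup>2 * c"
      by (simp add: c_def algebra_simps)
    finally show ?thesis unfolding nw .
  qed
  have "(norm w)\<^sup>2 = 0"
  proof (rule ccontr)
    assume "(norm w)\<^sup>2 \<noteq> 0"
    define a where "a = (norm w)\<^sup>2"
    have a: "a > 0" using \<open>(norm w)\<^sup>2 \<noteq> 0\<close> by (simp add: a_def)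
    \<comment> \<open>At \<open>t = - b\<close> the quadratic of \<open>main\<close> equals
      \<open>- (b * a) - b * b\<close>, which is negative. The summand \<open>1\<close> in the
      denominator covers \<open>c = 0\<close>.\<close>
    define b where "b = a / (c + 1)"
    have "a = b * (c + 1)" using c by (simp add: b_def)
    then have b: "b > 0" "a = b * c + b" using a c by (simp_all add: b_def distrib_left)
    have "0 \<le> - (2 * b * a) + b * (b * c)"
      using main[of "- b"] by (simp add: a_def power2_eq_square mult_ac)
    also have "\<dots> = - (b * a) - b * b" by (simp add: b(2) algebra_simps)
    also have "\<dots> < 0" using mult_pos_pos[OF b(1) a] mult_pos_pos[OF b(1) b(1)] by linarith
    finally show False by simp
  qed
  then have "A *v u = complex_of_real l *s u" by (simp add: w_def of_real_scale)
  then show ?thesis using uW nu by (auto simp: W_def)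
qed

lemma hermitian_orthonormal_eigenvectors:
  fixes A :: "('n::finite) op"
  assumes A: "hermitian A" and "m \<le> CARD('n)"
  shows "\<exists>E. finite E \<and> card E = m \<and> (\<forall>e\<in>E. \<exists>l. A *v e = complex_of_real l *s e) \<and>
    (\<forall>e\<in>E. \<forall>e'\<in>E. cinner e e' = (if e = e' then 1 else 0))"
  using assms(2)
proof (induction m)
  case 0
  then show ?case by (intro exI[of _ "{}"]) auto
next
  case (Suc m)
  then obtain E where E: "finite E" "card E = m"
    "\<forall>e\<in>E. \<exists>l. A *v e = complex_of_real l *s e"
    "\<forall>e\<in>E. \<forall>e'\<in>E. cinner e e' = (if e = e' then 1 else 0)"
    by auto
  then obtain u l where u: "norm u = 1" "A *v u = complex_of_real l *s u"
    "\<forall>e\<in>E. cinner e u = 0"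
    using hermitian_extend_eigenvectors[OF A, of E] Suc.prems by auto
  have uu: "cinner u u = 1" by (simp add: cinner_self u)
  with u have nE: "u \<notin> E" by auto
  have ue: "cinner u e = 0" if "e \<in> E" for e
    using u(3) that cinner_cnj[of e u] by simp
  have "finite (insert u E)" "card (insert u E) = Suc m" using E nE by simp_all
  moreover have "\<forall>e\<in>insert u E. \<exists>l. A *v e = complex_of_real l *s e" using E(3) u(2) by blast
  moreover have "\<forall>e\<in>insert u E. \<forall>e'\<in>insert u E. cinner e e' = (if e = e' then 1 else 0)"
  proof (intro ballI)
    fix e e' assume "e \<in> insert u E" "e' \<in> insert u E"
    then show "cinner e e' = (if e = e' then 1 else 0)"
      using E(4) u(3) uu ue nE by (cases "e = u"; cases "e' = u"; simp)
  qed
  ultimately show ?case by blast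
qed

section \<open>Unitary diagonalisation\<close>

definition diag :: "('n::finite \<Rightarrow> real) \<Rightarrow> 'n op" where
  "diag l = (\<chi> i j. if i = j then complex_of_real (l i) else 0)"

text \<open>The columns of \<open>Q\<close> are an orthonormal eigenbasis, and \<open>l\<close>
  lists the real eigenvalues with multiplicity. All spectral quantities below are evaluated on such
  data.\<close>

definition diagonalizes :: "('n::finite) op \<Rightarrow> ('n \<Rightarrow> real) \<Rightarrow> 'n op \<Rightarrow> bool" where
  "diagonalizes Q l A \<longleftrightarrow> unitary Q \<and> A = Q ** diag l ** dagger Q"

lemma mul_diag_nth: "(A ** diag l) $ i $ j = A $ i $ j * complex_of_real (l j)"
  by (simp add: matrix_matrix_mult_def diag_def if_distrib cong: if_cong)

lemma diag_mul_nth: "(diag l ** A) $ i $ j = complex_of_real (l i) * A $ i $ j"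
  by (simp add: matrix_matrix_mult_def diag_def if_distrib[of "\<lambda>x. x * _"] cong: if_cong)

lemma diag_mul_diag: "diag l ** diag m = diag (\<lambda>i. l i * m i)"
  by (simp add: vec_eq_iff mul_diag_nth) (simp add: diag_def)

lemma dagger_diag [simp]: "dagger (diag l) = diag l"
  by (simp add: vec_eq_iff diag_def)

lemma trace_diag: "trace (diag l) = complex_of_real (sum l UNIV)"
  by (simp add: trace_def diag_def)

lemma conj_diag_nth:
  "(Q ** diag l ** dagger Q) $ i $ j
     = (\<Sum>k\<in>UNIV. complex_of_real (l k) * Q $ i $ k * cnj (Q $ j $ k))"
  by (subst matrix_matrix_mult_def) (simp add: mul_diag_nth mult_ac)

lemma unitary_if_left_inverse: "dagger Q ** Q = mat 1 \<Longrightarrow> unitary Q"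
  unfolding unitary_def using matrix_left_right_inverse by blast

text \<open>A full orthonormal set of eigenvectors, enumerated by the index type, gives the columns
  of \<open>Q\<close>; the eigenvector equations then read
  \<open>A ** Q = Q ** diag l\<close>.\<close>

theorem hermitian_diagonalizable:
  fixes A :: "('n::finite) op"
  assumes A: "hermitian A"
  obtains Q l where "diagonalizes Q l A"
proof -
  obtain E where E: "finite E" "card E = CARD('n)"
    "\<forall>e\<in>E. \<exists>l. A *v e = complex_of_real l *s e"
    "\<forall>e\<in>E. \<forall>e'\<in>E. cinner e e' = (if e = e' then 1 else 0)"
    using hermitian_orthonormal_eigenvectors[OF A, of "CARD('n)"] by auto
  then obtain g :: "'n \<Rightarrow> _" where g: "bij_betw g UNIV E"
    by (metis bij_betw_iff_card finite)
  then have gE: "g k \<in> E" for k by (auto simp: bij_betw_def)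
  then have "\<forall>k. \<exists>l. A *v g k = complex_of_real l *s g k" using E(3) by blast
  then obtain l where l: "\<And>k. A *v g k = complex_of_real (l k) *s g k"
    unfolding choice_iff by blast
  define Q where "Q = (\<chi> i k. g k $ i)"
  have "cinner (g j) (g k) = (if j = k then 1 else 0)" for j k
    using E(4) gE g by (auto simp: bij_betw_def inj_on_def)
  then have "dagger Q ** Q = mat 1"
    by (simp add: vec_eq_iff matrix_matrix_mult_def cinner_def mat_def Q_def)
  then have U: "unitary Q" by (rule unitary_if_left_inverse)
  have "A ** Q = Q ** diag l"
    using l by (simp add: vec_eq_iff mul_diag_nth) 
      (simp add: matrix_matrix_mult_def matrix_vector_mult_def Q_def mult.commute)
  then have "A = Q ** diag l ** dagger Q"
    using U unfolding unitary_def by (metis matrix_mul_assoc matrix_mul_rid)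
  with U that show thesis unfolding diagonalizes_def by blast
qed

section \<open>Positive semidefinite matrices and states\<close>

lemma matrix_entry: "A $ i $ j = cinner (axis i 1) (A *v axis j 1)"
  by (simp add: cinner_def axis_def matrix_vector_mult_def if_distrib[of "\<lambda>x. _ * x"]
      if_distrib[of cnj] if_distrib[of "\<lambda>x. x * _"] cong: if_cong)

text \<open>Polarisation: the quadratic form is real at \<open>axis i 1 + c *s axis j 1\<close>.
  Taking \<open>c = 1\<close> compares the imaginary parts of the two mirrored entries, and
  \<open>c = \<i>\<close> their real parts.\<close>

lemma psd_hermitian:
  fixes A :: "('n::finite) op"
  assumes "psd A"
  shows "hermitian A"
proof -
  have im: "Im (cinner v (A *v v)) = 0" for v
    using assms by (metis psd_def complex_nonneg_Reals_iff)
  have "A $ i $ j = cnj (A $ j $ i)" for i j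
  proof -
    let ?b = "\<lambda>c. axis i 1 + c *s axis j 1 :: complex^'n"
    have "cinner (?b c) (A *v ?b c) = A $ i $ i + c * A $ i $ j + cnj c * A $ j $ i
        + cnj c * c * A $ j $ j" for c
      by (simp add: matrix_entry[of A] matrix_vector_right_distrib vector_scalar_commute
          cinner_add_right cinner_add_left cinner_scale_right cinner_scale_left algebra_simps)
    then have eq: "Im (c * A $ i $ j + cnj c * A $ j $ i) = 0" if "cnj c * c = 1" for c
      using im[of "?b c"] im[of "axis i 1"] im[of "axis j 1"] that
      by (simp add: matrix_entry[symmetric])
    show ?thesis using eq[of 1] eq[of \<i>] by (simp add: complex_eq_iff)
  qed
  then show ?thesis unfolding hermitian_def vec_eq_iff dagger_nth by metis
qed

lemma cinner_conj_diag:
  "cinner v ((Q ** diag l ** dagger Q) *v v)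
     = complex_of_real (\<Sum>k\<in>UNIV. l k * (cmod ((dagger Q *v v) $ k))\<^sup>2)"
proof -
  let ?w = "dagger Q *v v"
  have "(Q ** diag l ** dagger Q) *v v = Q *v (diag l *v ?w)"
    by (simp add: matrix_vector_mul_assoc matrix_mul_assoc)
  then have "cinner v ((Q ** diag l ** dagger Q) *v v) = cinner ?w (diag l *v ?w)"
    by (simp add: cinner_adjoint)
  also have "diag l *v ?w = (\<chi> k. complex_of_real (l k) * ?w $ k)"
    by (simp add: vec_eq_iff matrix_vector_mult_def diag_def if_distrib[of "\<lambda>x. x * _"]
        cong: if_cong)
  also have "cinner ?w \<dots> = complex_of_real (\<Sum>k\<in>UNIV. l k * (cmod (?w $ k))\<^sup>2)"
    by (simp add: cinner_def complex_norm_square mult_ac del: of_real_power)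
  finally show ?thesis .
qed

lemma diagonalizes_psd_iff:
  assumes "diagonalizes Q l A"
  shows "psd A \<longleftrightarrow> (\<forall>k. 0 \<le> l k)"
proof
  assume P: "psd A"
  have Q: "dagger Q ** Q = mat 1" and A: "A = Q ** diag l ** dagger Q"
    using assms by (auto simp: diagonalizes_def unitary_def)
  show "\<forall>k. 0 \<le> l k"
  proof
    fix k
    have "dagger Q *v (Q *v axis k 1) = axis k 1"
      by (simp add: matrix_vector_mul_assoc Q)
    then have "cinner (Q *v axis k 1) (A *v (Q *v axis k 1)) = complex_of_real (l k)"
      by (simp add: A cinner_conj_diag axis_def if_distrib[of "\<lambda>x. _ * x"]
          if_distrib[of "\<lambda>x. x\<^sup>2"] if_distrib[of cmod] cong: if_cong)
    then show "0 \<le> l k" using P by (metis psd_def nonneg_Reals_of_real_iff)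
  qed
next
  assume "\<forall>k. 0 \<le> l k"
  then show "psd A"
    using assms by (auto simp: psd_def diagonalizes_def cinner_conj_diag nonneg_Reals_of_real_iff
        intro!: sum_nonneg simp del: of_real_sum of_real_mult)
qed

lemma trace_conj: "unitary Q \<Longrightarrow> trace (Q ** A ** dagger Q) = trace A"
  by (metis matrix_mul_assoc matrix_mul_lid trace_mul_sym unitary_def)

lemma diagonalizes_trace: "diagonalizes Q l A \<Longrightarrow> trace A = complex_of_real (sum l UNIV)"
  by (simp add: diagonalizes_def trace_conj trace_diag)

lemma diagonalizes_state_iff:
  assumes "diagonalizes Q l A"
  shows "state A \<longleftrightarrow> (\<forall>k. 0 \<le> l k) \<and> sum l UNIV = 1"
  by (metis assms diagonalizes_psd_iff diagonalizes_trace of_real_eq_1_iff state_def)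

lemma state_diagonalizable:
  assumes "state \<rho>"
  obtains Q p where "diagonalizes Q p \<rho>" "\<And>k. 0 \<le> p k" "sum p UNIV = 1"
  by (metis assms diagonalizes_state_iff hermitian_diagonalizable psd_hermitian state_def)

section \<open>Entropies in an eigenbasis\<close>

lemma unitary_dagger_inverse:
  assumes "unitary Q"
  shows "Q *v (dagger Q *v v) = v" "dagger Q *v (Q *v v) = v"
  using assms by (simp_all add: unitary_def matrix_vector_mul_assoc)

lemma conj_mul_conj:
  assumes "unitary Q"
  shows "(Q ** A ** dagger Q) ** (Q ** B ** dagger Q) = Q ** (A ** B) ** dagger Q"
proof -
  have Q: "dagger Q ** Q = mat 1" using assms by (simp add: unitary_def)
  have "(Q ** A ** dagger Q) ** (Q ** B ** dagger Q) = Q ** A ** (dagger Q ** Q) ** B ** dagger Q"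
    by (simp add: matrix_mul_assoc)
  also have "\<dots> = Q ** (A ** B) ** dagger Q"
    unfolding Q matrix_mul_rid by (simp add: matrix_mul_assoc)
  finally show ?thesis .
qed

lemma diag_mul_vec_nth: "(diag l *v v) $ k = complex_of_real (l k) * v $ k"
  by (simp add: matrix_vector_mult_def diag_def if_distrib[of "\<lambda>x. x * _"] cong: if_cong)

text \<open>In the coordinates \<open>dagger Q *v v\<close> the matrix is diagonal, so the equation
  decouples. It serves eigenspaces and, with \<open>c = 1\<close>, the fixed vectors of
  projectors.\<close>

lemma conj_diag_eigenvector_iff:
  assumes Q: "unitary Q"
  shows "(Q ** diag l ** dagger Q) *v v = c *s v \<longleftrightarrow>
    (\<forall>k. complex_of_real (l k) * (dagger Q *v v) $ k = c * (dagger Q *v v) $ k)"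
proof -
  let ?w = "dagger Q *v v"
  have "(Q ** diag l ** dagger Q) *v v = Q *v (diag l *v ?w)"
    by (simp add: matrix_vector_mul_assoc matrix_mul_assoc)
  moreover have "c *s v = Q *v (c *s ?w)"
    by (simp add: vector_scalar_commute unitary_dagger_inverse[OF Q])
  ultimately have "(Q ** diag l ** dagger Q) *v v = c *s v \<longleftrightarrow> diag l *v ?w = c *s ?w"
    using unitary_dagger_inverse(2)[OF Q] by metis
  then show ?thesis by (simp add: vec_eq_iff diag_mul_vec_nth)
qed

lemma eigenvalues_diagonalizes:
  assumes "diagonalizes Q l A"
  shows "eigenvalues A = range l"
proof -
  have Q: "unitary Q" and A: "A = Q ** diag l ** dagger Q"
    using assms by (auto simp: diagonalizes_def)
  show ?thesis
  proof safe
    fix x assume "x \<in> eigenvalues A"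
    then obtain v where v: "v \<noteq> 0" "A *v v = complex_of_real x *s v"
      by (auto simp: eigenvalues_def eigenspace_def)
    let ?w = "dagger Q *v v"
    have "?w \<noteq> 0" using v(1) unitary_dagger_inverse(1)[OF Q, of v] by auto
    then obtain k where "?w $ k \<noteq> 0" by (auto simp: vec_eq_iff)
    moreover have "complex_of_real (l k) * ?w $ k = complex_of_real x * ?w $ k"
      using v(2) unfolding A conj_diag_eigenvector_iff[OF Q] by blast
    ultimately show "x \<in> range l" by auto
  next
    fix k
    let ?v = "Q *v axis k 1"
    have w: "dagger Q *v ?v = axis k 1" by (rule unitary_dagger_inverse(2)[OF Q])
    have "A *v ?v = complex_of_real (l k) *s ?v"
      unfolding A conj_diag_eigenvector_iff[OF Q] w by (simp add: axis_def)
    moreover have "?v \<noteq> 0" using w by (metis axis_eq_0_iff matrix_vector_mult_0_right zero_neq_one)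
    ultimately show "l k \<in> eigenvalues A" by (auto simp: eigenvalues_def eigenspace_def)
  qed
qed

lemma hermitian_conj_diag: "hermitian (Q ** diag l ** dagger Q)"
  by (simp add: hermitian_def dagger_mul matrix_mul_assoc)

text \<open>Each projector fixes the common range, so \<open>P ** P' = P'\<close> and
  \<open>P' ** P = P\<close>; taking adjoints identifies them. This justifies the definite
  description in \<open>eigenprojector\<close>.\<close>

lemma orthogonal_projector_unique:
  assumes "hermitian P" "P ** P = P" "hermitian P'" "P' ** P' = P'"
    and range: "range (\<lambda>v. P *v v) = range (\<lambda>v. P' *v v)"
  shows "P = P'"
proof -
  have absorb: "R ** S = S" if R: "R ** R = R" "range (\<lambda>v. R *v v) = range (\<lambda>v. S *v v)"
    for R S :: "'a op"
  proof -
    have "R *v (S *v v) = S *v v" for v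
    proof -
      obtain u where "S *v v = R *v u" using R(2) by blast
      then show ?thesis using R(1) by (simp add: matrix_vector_mul_assoc)
    qed
    then show ?thesis by (simp add: matrix_eq matrix_vector_mul_assoc)
  qed
  have "P' = P ** P'" using assms absorb by metis
  also have "\<dots> = dagger (P' ** P)" using assms by (simp add: dagger_mul hermitian_def)
  also have "P' ** P = P" using assms absorb by metis
  finally show ?thesis using assms by (simp add: hermitian_def)
qed

lemma eigenprojector_diagonalizes:
  assumes "diagonalizes Q l A"
  shows "eigenprojector A x = Q ** diag (\<lambda>k. of_bool (l k = x)) ** dagger Q"
    (is "_ = ?P")
proof -
  have Q: "unitary Q" and A: "A = Q ** diag l ** dagger Q"
    using assms by (auto simp: diagonalizes_def)
  have PP: "?P ** ?P = ?P" unfolding conj_mul_conj[OF Q] diag_mul_diag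
    by (simp flip: of_bool_conj)
  have "v \<in> range (\<lambda>v. ?P *v v) \<longleftrightarrow> v \<in> eigenspace A x" for v
  proof -
    \<comment> \<open>The range of a projector is its set of fixed vectors. Both these and the
      eigenvectors for \<open>x\<close> are the vectors whose coordinates vanish at every
      \<open>k\<close> with \<open>l k \<noteq> x\<close>.\<close>
    have "v \<in> range (\<lambda>v. ?P *v v) \<longleftrightarrow> ?P *v v = 1 *s v"
      using PP by (auto simp: matrix_vector_mul_assoc) (metis rangeI)
    also have "\<dots> \<longleftrightarrow> v \<in> eigenspace A x"
      unfolding conj_diag_eigenvector_iff[OF Q] eigenspace_def mem_Collect_eq A
      by (intro all_cong1) (auto simp: of_bool_def)
    finally show ?thesis .
  qed
  then have R: "range (\<lambda>v. ?P *v v) = eigenspace A x" by blast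
  show ?thesis unfolding eigenprojector_def
  proof (rule the_equality)
    show "hermitian ?P \<and> ?P ** ?P = ?P \<and> range (\<lambda>v. ?P *v v) = eigenspace A x"
      using PP R hermitian_conj_diag by blast
  next
    fix P assume "hermitian P \<and> P ** P = P \<and> range (\<lambda>v. P *v v) = eigenspace A x"
    then show "P = ?P" using PP R hermitian_conj_diag orthogonal_projector_unique by metis
  qed
qed

lemma matrix_fun_diagonalizes:
  fixes Q :: "('n::finite) op"
  assumes "diagonalizes Q l A"
  shows "matrix_fun f A = Q ** diag (\<lambda>k. f (l k)) ** dagger Q"
proof -
  have "matrix_fun f A $ i $ j = (Q ** diag (\<lambda>k. f (l k)) ** dagger Q) $ i $ j" for i j
  proof -
    let ?g = "\<lambda>k. Q $ i $ k * cnj (Q $ j $ k)"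
    have "matrix_fun f A $ i $ j
        = (\<Sum>x\<in>range l. \<Sum>k\<in>UNIV. complex_of_real (f x) * of_bool (l k = x) * ?g k)"
      by (simp add: matrix_fun_def eigenvalues_diagonalizes[OF assms]
          eigenprojector_diagonalizes[OF assms] conj_diag_nth scaleR_conv_of_real[where 'a = complex]
          sum_distrib_left mult_ac of_bool_def if_distrib[of complex_of_real]
          cong: if_cong)
    \<comment> \<open>\<open>matrix_fun\<close> sums over distinct eigenvalues; after the exchange
      each index \<open>k\<close> keeps only \<open>x = l k\<close>, which restores the
      multiplicities.\<close>
    also have "\<dots> = (\<Sum>k\<in>UNIV. \<Sum>x\<in>range l. complex_of_real (f x) * of_bool (l k = x) * ?g k)"
      by (rule sum.swap)
    also have "\<dots> = (\<Sum>k\<in>UNIV. complex_of_real (f (l k)) * ?g k)"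
    proof (rule sum.cong[OF refl])
      fix k
      have "(\<Sum>x\<in>range l. complex_of_real (f x) * of_bool (l k = x) * ?g k)
          = (\<Sum>x\<in>range l. if x = l k then complex_of_real (f x) * ?g k else 0)"
        by (intro sum.cong) auto
      then show "(\<Sum>x\<in>range l. complex_of_real (f x) * of_bool (l k = x) * ?g k)
          = complex_of_real (f (l k)) * ?g k"
        by simp
    qed
    finally show ?thesis by (simp add: conj_diag_nth mult_ac)
  qed
  then show ?thesis by (simp add: vec_eq_iff)
qed

lemma entropy_diagonalizes:
  assumes "diagonalizes Q l A"
  shows "entropy A = - (\<Sum>k\<in>UNIV. l k * log 2 (l k))"
proof -
  have Q: "unitary Q" and A: "A = Q ** diag l ** dagger Q"
    using assms by (auto simp: diagonalizes_def)
  have "A ** matrix_fun (log 2) A = Q ** diag (\<lambda>k. l k * log 2 (l k)) ** dagger Q"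
    by (simp add: matrix_fun_diagonalizes[OF assms]) (simp add: A conj_mul_conj[OF Q] diag_mul_diag)
  then show ?thesis by (simp add: entropy_def trace_conj[OF Q] trace_diag)
qed

text \<open>The conjugated columns \<open>q k\<close> with \<open>k \<in> K\<close> form a basis of
  the row space: the rows are combinations of them, and orthonormality both inverts these
  combinations and gives independence.\<close>

lemma rank_coordinate_projector:
  fixes Q :: "('n::finite) op"
  assumes Q: "unitary Q"
  shows "rank (Q ** diag (\<lambda>k. of_bool (k \<in> K)) ** dagger Q) = card K"
proof -
  let ?P = "Q ** diag (\<lambda>k. of_bool (k \<in> K)) ** dagger Q"
  define q where "q k = (\<chi> j. cnj (Q $ j $ k))" for k
  have orth: "(\<Sum>i\<in>UNIV. cnj (Q $ i $ k) * Q $ i $ m) = of_bool (k = m)" for k m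
  proof -
    have "(dagger Q ** Q) $ k $ m = mat 1 $ k $ m" using Q by (simp add: unitary_def)
    then show ?thesis by (simp add: matrix_matrix_mult_def mat_def)
  qed
  have row: "row i ?P = (\<Sum>k\<in>K. Q $ i $ k *s q k)" for i
    by (simp add: vec_eq_iff row_def conj_diag_nth q_def of_bool_def if_distrib[of "\<lambda>x. x * _"]
        if_distrib[of complex_of_real] sum.If_cases cong: if_cong)
  have comb: "q k = (\<Sum>i\<in>UNIV. cnj (Q $ i $ k) *s row i ?P)" if k: "k \<in> K" for k
  proof -
    have "(\<Sum>i\<in>UNIV. cnj (Q $ i $ k) *s row i ?P)
        = (\<Sum>i\<in>UNIV. \<Sum>m\<in>K. (cnj (Q $ i $ k) * Q $ i $ m) *s q m)"
      unfolding row by (simp add: vec_eq_iff sum_distrib_left mult_ac)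
    also have "\<dots> = (\<Sum>m\<in>K. \<Sum>i\<in>UNIV. (cnj (Q $ i $ k) * Q $ i $ m) *s q m)"
      by (rule sum.swap)
    also have "\<dots> = (\<Sum>m\<in>K. of_bool (k = m) *s q m)"
      by (simp only: orth[symmetric]) (simp add: vec_eq_iff sum_distrib_right)
    also have "\<dots> = (\<Sum>m\<in>K. if m = k then q m else 0)"
      by (intro sum.cong) (auto simp: vec_eq_iff)
    also have "\<dots> = q k" using k by simp
    finally show ?thesis by simp
  qed
  have rows: "rows ?P = range (\<lambda>i. row i ?P)" by (auto simp: rows_def)
  have "row i ?P \<in> vec.span (q ` K)" for i
    unfolding row by (intro vec.span_sum vec.span_scale vec.span_base imageI)
  moreover have "q k \<in> vec.span (rows ?P)" if "k \<in> K" for k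
    unfolding rows
    by (subst comb[OF that]) (intro vec.span_sum vec.span_scale vec.span_base rangeI)
  ultimately have span: "vec.span (rows ?P) = vec.span (q ` K)"
    unfolding vec.span_eq rows by blast
  have orth': "(\<Sum>j\<in>UNIV. Q $ j $ m * q k $ j) = of_bool (k = m)" for k m
    using orth[of k m] by (simp add: q_def mult.commute)
  have inj: "inj q"
  proof (rule injI)
    fix k m assume eq: "q k = q m"
    have "of_bool (m = k) = (of_bool (k = k) :: complex)"
      unfolding orth'[symmetric] eq ..
    then show "k = m" by (simp split: if_splits)
  qed
  have "vec.independent (q ` K)"
    unfolding vec.independent_explicit_finite_subsets
  proof (intro allI impI ballI)
    fix S u v
    assume S: "S \<subseteq> q ` K" "finite S" and 0: "(\<Sum>v\<in>S. u v *s v) = 0" and v: "v \<in> S"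
    obtain k where k: "v = q k" using S v by auto
    \<comment> \<open>Pairing the linear relation with column \<open>k\<close> of \<open>Q\<close>
      isolates the coefficient of \<open>q k\<close>.\<close>
    have "u v = (\<Sum>v'\<in>S. if v' = v then u v' else 0)" using S v by simp
    also have "\<dots> = (\<Sum>v'\<in>S. u v' * (\<Sum>j\<in>UNIV. Q $ j $ k * v' $ j))"
    proof (intro sum.cong refl)
      fix v' assume "v' \<in> S"
      then obtain k' where k': "v' = q k'" using S by auto
      show "(if v' = v then u v' else 0) = u v' * (\<Sum>j\<in>UNIV. Q $ j $ k * v' $ j)"
        unfolding k k' orth' using inj by (auto simp: inj_eq)
    qed
    also have "\<dots> = (\<Sum>j\<in>UNIV. Q $ j $ k * (\<Sum>v'\<in>S. u v' *s v') $ j)"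
      by (simp add: sum_distrib_left sum_distrib_right mult_ac)
         (rule sum.swap)
    also have "\<dots> = 0" by (simp only: 0) simp
    finally show "u v = 0" .
  qed
  then have "vec.dim (q ` K) = card (q ` K)" by (rule vec.dim_eq_card_independent)
  also have "\<dots> = card K" using inj by (simp add: card_image inj_on_subset[OF inj])
  finally show ?thesis unfolding row_rank_def_gen
    using span by (metis vec.dim_span)
qed

text \<open>An eigenvalue of multiplicity \<open>r\<close> occurs \<open>r\<close> times among the
  \<open>s m\<close>; grouping the indices by value produces the factor \<open>r\<close> of the
  definition.\<close>

lemma catalytic_entropy_diagonalizes:
  fixes \<sigma> :: "('n::finite) op"
  assumes "diagonalizes Q s \<sigma>"
  shows "catalytic_entropy \<sigma> = - (\<Sum>m\<in>UNIV. s m * log 2 (s m / real (card {n. s n = s m})))"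
proof -
  have Q: "unitary Q" using assms by (simp add: diagonalizes_def)
  have r: "rank (eigenprojector \<sigma> x) = card {n. s n = x}" for x
    using rank_coordinate_projector[OF Q, of "{n. s n = x}"]
    by (simp add: eigenprojector_diagonalizes[OF assms])
  let ?h = "\<lambda>m. s m * log 2 (s m / real (card {n. s n = s m}))"
  have "(\<Sum>m\<in>UNIV. ?h m) = (\<Sum>x\<in>range s. sum ?h {m \<in> UNIV. s m = x})"
    by (rule sum.image_gen) simp
  also have "\<dots> = (\<Sum>x\<in>range s. x * real (card {n. s n = x}) * log 2 (x / real (card {n. s n = x})))"
    by (intro sum.cong) (simp_all add: mult_ac)
  finally show ?thesis
    by (simp add: catalytic_entropy_def eigenvalues_diagonalizes[OF assms] r Let_def)
qed

section \<open>Gibbs' inequality for sums of rank one operators\<close>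

lemma cinner_outer_sum:
  fixes w :: "'j \<Rightarrow> complex^'n"
  shows "cinner v ((\<chi> a b. \<Sum>j\<in>J. w j $ a * cnj (w j $ b)) *v v)
    = complex_of_real (\<Sum>j\<in>J. (cmod (cinner v (w j)))\<^sup>2)"
proof -
  have "cinner v ((\<chi> a b. \<Sum>j\<in>J. w j $ a * cnj (w j $ b)) *v v)
      = (\<Sum>a\<in>UNIV. \<Sum>b\<in>UNIV. \<Sum>j\<in>J. (cnj (v $ a) * w j $ a) * (cnj (w j $ b) * v $ b))"
    by (simp add: cinner_def matrix_vector_mult_def sum_distrib_left sum_distrib_right mult_ac)
  also have "\<dots> = (\<Sum>a\<in>UNIV. \<Sum>j\<in>J. \<Sum>b\<in>UNIV. (cnj (v $ a) * w j $ a) * (cnj (w j $ b) * v $ b))"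
    by (intro sum.cong refl sum.swap)
  also have "\<dots> = (\<Sum>j\<in>J. \<Sum>a\<in>UNIV. \<Sum>b\<in>UNIV. (cnj (v $ a) * w j $ a) * (cnj (w j $ b) * v $ b))"
    by (rule sum.swap)
  also have "\<dots> = (\<Sum>j\<in>J. cinner v (w j) * cinner (w j) v)"
    by (simp add: cinner_def sum_product)
  also have "\<dots> = (\<Sum>j\<in>J. cinner v (w j) * cnj (cinner v (w j)))"
    by (simp only: cinner_cnj)
  finally show ?thesis by (simp add: complex_norm_square del: of_real_power)
qed

lemma norm_unitary:
  assumes "unitary Q"
  shows "norm (Q *v v) = norm v"
proof -
  have "inner (Q *v v) (Q *v v) = inner v v"
    unfolding inner_eq_Re_cinner cinner_adjoint unitary_dagger_inverse(2)[OF assms] ..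
  then show ?thesis by (simp add: norm_eq_sqrt_inner)
qed

lemma norm_square_vec: "(norm (v :: complex^'n))\<^sup>2 = (\<Sum>k\<in>UNIV. (cmod (v $ k))\<^sup>2)"
  by (simp add: norm_vec_def L2_set_def sum_nonneg)

text \<open>
  Gibbs' inequality for the weights \<open>c j k = |\<langle>e\<^sub>k, w\<^sub>j\<rangle>|\<^sup>2\<close>, where \<open>e\<^sub>k\<close> are the eigenvectors of \<open>\<omega>\<close>.
  It needs \<open>x = \<langle>w\<^sub>j, \<omega>\<^sup>-\<^sup>1 w\<^sub>j\<rangle> \<le> 1\<close>, which follows from \<open>x\<^sup>2 = |\<langle>\<omega>\<^sup>-\<^sup>1 w\<^sub>j, w\<^sub>j\<rangle>|\<^sup>2 \<le> x\<close>.
\<close>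

lemma entropy_outer_sum_le:
  fixes w :: "'j \<Rightarrow> complex^('n::finite)" and \<omega> :: "'n op"
  assumes J: "finite J" and st: "state \<omega>"
    and \<omega>: "\<omega> = (\<chi> a b. \<Sum>j\<in>J. w j $ a * cnj (w j $ b))"
    and y: "\<And>j. j \<in> J \<Longrightarrow> 0 \<le> y j" "sum y J \<le> 1"
    and pos: "\<And>j. j \<in> J \<Longrightarrow> w j \<noteq> 0 \<Longrightarrow> 0 < y j"
  shows "entropy \<omega> \<le> - (\<Sum>j\<in>J. (norm (w j))\<^sup>2 * log 2 (y j))"
proof -
  obtain Q \<mu> where D: "diagonalizes Q \<mu> \<omega>" and \<mu>: "\<And>k. 0 \<le> \<mu> k" "sum \<mu> UNIV = 1"
    using state_diagonalizable[OF st] by blast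
  have Q: "unitary Q" and \<omega>Q: "\<omega> = Q ** diag \<mu> ** dagger Q"
    using D by (auto simp: diagonalizes_def)
  define a where "a j = dagger Q *v w j" for j
  define c where "c j k = (cmod (a j $ k))\<^sup>2" for j k
  have c0: "0 \<le> c j k" for j k by (simp add: c_def)
  \<comment> \<open>The quadratic form of \<open>\<omega>\<close> at \<open>Q *v z\<close>, computed
    once from the spectral decomposition and once from the rank one decomposition.\<close>
  have form: "(\<Sum>k\<in>UNIV. \<mu> k * (cmod (z $ k))\<^sup>2) = (\<Sum>j\<in>J. (cmod (cinner z (a j)))\<^sup>2)" for z
  proof -
    let ?v = "Q *v z"
    have "complex_of_real (\<Sum>k\<in>UNIV. \<mu> k * (cmod (z $ k))\<^sup>2)
        = complex_of_real (\<Sum>j\<in>J. (cmod (cinner ?v (w j)))\<^sup>2)"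
      using cinner_conj_diag[of ?v Q \<mu>] cinner_outer_sum[of ?v w J]
      by (simp only: unitary_dagger_inverse(2)[OF Q] \<omega>Q[symmetric] \<omega>[symmetric])
    moreover have "cinner ?v (w j) = cinner z (a j)" for j
      using cinner_adjoint[of z "dagger Q" "w j"] by (simp add: a_def)
    ultimately show ?thesis by (simp only: of_real_eq_iff)
  qed
  have \<mu>c: "\<mu> k = (\<Sum>j\<in>J. c j k)" for k
    using form[of "axis k 1"]
    by (simp add: c_def cinner_def axis_def if_distrib[of "\<lambda>x. _ * x"] if_distrib[of "\<lambda>x. x * _"]
      if_distrib[of "\<lambda>x. x\<^sup>2"] if_distrib[of cmod] if_distrib[of cnj] cong: if_cong)
  have qc: "(norm (w j))\<^sup>2 = (\<Sum>k\<in>UNIV. c j k)" for j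
    unfolding c_def norm_square_vec[symmetric] a_def norm_unitary[OF unitary_dagger[OF Q]] ..
  \<comment> \<open>Weights vanish on the kernel of \<open>\<omega>\<close>, so the convention
    \<open>x / 0 = 0\<close> in the quotients by \<open>\<mu> k\<close> below agrees with inverting
    \<open>\<omega>\<close> on its support.\<close>
  have c\<mu>: "0 < \<mu> k" if "j \<in> J" "c j k \<noteq> 0" for j k
  proof -
    have "0 < c j k" using that c0[of j k] by linarith
    also have "\<dots> \<le> \<mu> k" unfolding \<mu>c using that J c0 by (intro member_le_sum) auto
    finally show ?thesis .
  qed
  have bessel: "(\<Sum>k\<in>UNIV. c j k / \<mu> k) \<le> 1" if j: "j \<in> J" for j
  proof -
    define x where "x = (\<Sum>k\<in>UNIV. c j k / \<mu> k)"
    \<comment> \<open>The vector obtained from \<open>w j\<close> by the inverse of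
      \<open>\<omega>\<close> on its support, in eigenbasis coordinates.\<close>
    define z where "z = (\<chi> k. a j $ k / complex_of_real (\<mu> k))"
    have x0: "0 \<le> x" unfolding x_def using c0 \<mu> by (intro sum_nonneg) simp
    have "cinner z (a j) = complex_of_real x"
      by (simp add: cinner_def z_def x_def c_def complex_norm_square mult_ac del: of_real_power)
    then have "x\<^sup>2 \<le> (\<Sum>i\<in>J. (cmod (cinner z (a i)))\<^sup>2)"
      using j J member_le_sum[of j J "\<lambda>i. (cmod (cinner z (a i)))\<^sup>2"] by simp
    also have "\<dots> = (\<Sum>k\<in>UNIV. \<mu> k * (cmod (z $ k))\<^sup>2)" by (rule form[symmetric])
    also have "\<dots> = x"
      unfolding x_def
    proof (intro sum.cong refl)
      fix k
      show "\<mu> k * (cmod (z $ k))\<^sup>2 = c j k / \<mu> k"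
        using \<mu>(1)[of k] by (simp add: z_def c_def norm_divide power_divide power2_eq_square)
    qed
    finally have "x * x \<le> x * 1" by (simp add: power2_eq_square)
    then show ?thesis using x0 unfolding x_def[symmetric]
      by (metis mult_le_cancel_left_pos order_le_less zero_le_one)
  qed
  have "entropy \<omega> + (\<Sum>j\<in>J. (norm (w j))\<^sup>2 * log 2 (y j))
      = (\<Sum>j\<in>J. \<Sum>k\<in>UNIV. c j k * (log 2 (y j) - log 2 (\<mu> k)))"
  proof -
    have "(\<Sum>k\<in>UNIV. \<mu> k * log 2 (\<mu> k)) = (\<Sum>k\<in>UNIV. \<Sum>j\<in>J. c j k * log 2 (\<mu> k))"
      by (intro sum.cong refl) (subst \<mu>c, simp add: sum_distrib_right)
    also have "\<dots> = (\<Sum>j\<in>J. \<Sum>k\<in>UNIV. c j k * log 2 (\<mu> k))" by (rule sum.swap)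
    finally show ?thesis
      by (simp add: entropy_diagonalizes[OF D] qc sum_distrib_right right_diff_distrib
          sum_subtractf)
  qed
  \<comment> \<open>The bound \<open>ln x \<le> x - 1\<close> at \<open>x = y j / \<mu> k\<close>,
    weighted by \<open>c j k\<close>. Where the weight is nonzero both \<open>y j\<close> and
    \<open>\<mu> k\<close> are positive; elsewhere both sides are zero.\<close>
  also have "\<dots> \<le> (\<Sum>j\<in>J. \<Sum>k\<in>UNIV. (y j * (c j k / \<mu> k) - c j k) / ln 2)"
  proof (intro sum_mono)
    fix j k assume j: "j \<in> J"
    show "c j k * (log 2 (y j) - log 2 (\<mu> k)) \<le> (y j * (c j k / \<mu> k) - c j k) / ln 2"
    proof (cases "c j k = 0")
      case True then show ?thesis by simp
    next
      case False
      then have mu: "0 < \<mu> k" using c\<mu> j by blast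
      have "w j \<noteq> 0" using False by (auto simp: c_def a_def)
      then have yj: "0 < y j" using pos j by blast
      have "log 2 (y j) - log 2 (\<mu> k) = ln (y j / \<mu> k) / ln 2"
        using mu yj by (simp add: log_def ln_div diff_divide_distrib)
      also have "\<dots> \<le> (y j / \<mu> k - 1) / ln 2"
        using mu yj by (intro divide_right_mono ln_le_minus_one) auto
      finally have "c j k * (log 2 (y j) - log 2 (\<mu> k)) \<le> c j k * ((y j / \<mu> k - 1) / ln 2)"
        using c0 by (rule mult_left_mono)
      also have "\<dots> = (y j * (c j k / \<mu> k) - c j k) / ln 2"
        by (simp add: right_diff_distrib mult_ac)
      finally show ?thesis .
    qed
  qed
  also have "\<dots> = ((\<Sum>j\<in>J. y j * (\<Sum>k\<in>UNIV. c j k / \<mu> k)) - (\<Sum>j\<in>J. \<Sum>k\<in>UNIV. c j k)) / ln 2"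
    by (simp add: sum_divide_distrib[symmetric] sum_subtractf sum_distrib_left)
  also have "(\<Sum>j\<in>J. \<Sum>k\<in>UNIV. c j k) = 1"
    using \<mu>(2) unfolding \<mu>c by (subst sum.swap)
  also have "((\<Sum>j\<in>J. y j * (\<Sum>k\<in>UNIV. c j k / \<mu> k)) - 1) / ln 2 \<le> 0"
  proof -
    have "(\<Sum>j\<in>J. y j * (\<Sum>k\<in>UNIV. c j k / \<mu> k)) \<le> (\<Sum>j\<in>J. y j * 1)"
      using bessel y(1) by (intro sum_mono mult_left_mono)
    with y(2) show ?thesis by (simp add: divide_nonpos_pos)
  qed
  finally show ?thesis by simp
qed

section \<open>Tensor products of operators and states\<close>

lemma sum_UNIV_pair: "(\<Sum>p\<in>UNIV. f p) = (\<Sum>i\<in>UNIV. \<Sum>j\<in>UNIV. f (i, j))"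
  by (simp add: sum.cartesian_product flip: UNIV_Times_UNIV)

lemma tensor_mul: "tensor A B ** tensor C D = tensor (A ** C) (B ** D)"
  by (simp add: vec_eq_iff tensor_def matrix_matrix_mult_def sum_UNIV_pair sum_product mult_ac)

lemma dagger_tensor: "dagger (tensor A B) = tensor (dagger A) (dagger B)"
  by (simp add: vec_eq_iff tensor_def)

lemma tensor_mat_1: "tensor (mat 1) (mat 1) = mat 1"
  by (auto simp add: vec_eq_iff tensor_def mat_def)

lemma tensor_diag: "tensor (diag p) (diag s) = diag (\<lambda>x. p (fst x) * s (snd x))"
  by (auto simp add: vec_eq_iff tensor_def diag_def prod_eq_iff)

lemma unitary_tensor: "unitary P \<Longrightarrow> unitary Q \<Longrightarrow> unitary (tensor P Q)"
  by (simp add: unitary_def dagger_tensor tensor_mul tensor_mat_1)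

lemma diagonalizes_tensor:
  assumes "diagonalizes P p A" "diagonalizes Q s B"
  shows "diagonalizes (tensor P Q) (\<lambda>x. p (fst x) * s (snd x)) (tensor A B)"
  using assms by (simp add: diagonalizes_def unitary_tensor dagger_tensor tensor_mul
      flip: tensor_diag)

lemma state_tensor:
  assumes "state A" "state B"
  shows "state (tensor A B)"
proof -
  obtain P p where P: "diagonalizes P p A" "\<And>k. 0 \<le> p k" "sum p UNIV = 1"
    using state_diagonalizable[OF assms(1)] by blast
  obtain Q s where Q: "diagonalizes Q s B" "\<And>k. 0 \<le> s k" "sum s UNIV = 1"
    using state_diagonalizable[OF assms(2)] by blast
  show ?thesis unfolding diagonalizes_state_iff[OF diagonalizes_tensor[OF P(1) Q(1)]]
    using P Q by (simp add: sum_UNIV_pair sum_product[symmetric])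
qed

lemma entropy_tensor:
  assumes "state A" "state B"
  shows "entropy (tensor A B) = entropy A + entropy B"
proof -
  obtain P p where P: "diagonalizes P p A" "\<And>k. 0 \<le> p k" "sum p UNIV = 1"
    using state_diagonalizable[OF assms(1)] by blast
  obtain Q s where Q: "diagonalizes Q s B" "\<And>k. 0 \<le> s k" "sum s UNIV = 1"
    using state_diagonalizable[OF assms(2)] by blast
  \<comment> \<open>The logarithm of the product splits when both factors are positive; if one is
    zero, every term vanishes.\<close>
  have "p i * s j * log 2 (p i * s j) = (p i * log 2 (p i)) * s j + p i * (s j * log 2 (s j))"
    for i j
    using P(2)[of i] Q(2)[of j]
    by (cases "p i = 0"; cases "s j = 0") (simp_all add: log_mult algebra_simps)
  then have "(\<Sum>i\<in>UNIV. \<Sum>j\<in>UNIV. p i * s j * log 2 (p i * s j))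
      = (\<Sum>i\<in>UNIV. p i * log 2 (p i)) * sum s UNIV + sum p UNIV * (\<Sum>j\<in>UNIV. s j * log 2 (s j))"
    by (simp add: sum.distrib sum_product)
  then show ?thesis
    by (simp add: entropy_diagonalizes[OF diagonalizes_tensor[OF P(1) Q(1)]]
        entropy_diagonalizes[OF P(1)] entropy_diagonalizes[OF Q(1)] P Q sum_UNIV_pair)
qed

section \<open>Continuity of the entropy and attained maxima\<close>

lemma continuous_on_matrix_mul [continuous_intros]:
  fixes f g :: "'t::topological_space \<Rightarrow> ('n::finite) op"
  assumes "continuous_on S f" "continuous_on S g"
  shows "continuous_on S (\<lambda>x. f x ** g x)"
  unfolding matrix_matrix_mult_def using assms by (intro continuous_intros)

lemma continuous_on_trace [continuous_intros]:
  fixes f :: "'t::topological_space \<Rightarrow> ('n::finite) op"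
  assumes "continuous_on S f"
  shows "continuous_on S (\<lambda>x. trace (f x))"
  unfolding trace_def using assms by (intro continuous_intros)

lemma diag_one: "diag (\<lambda>_. 1) = mat 1"
  by (simp add: vec_eq_iff diag_def mat_def)

lemma diagonalizes_power:
  assumes "diagonalizes Q l A"
  shows "((**) A ^^ n) (mat 1) = Q ** diag (\<lambda>k. l k ^ n) ** dagger Q"
proof -
  have Q: "unitary Q" and A: "A = Q ** diag l ** dagger Q"
    using assms by (auto simp: diagonalizes_def)
  show ?thesis
  proof (induction n)
    case 0
    then show ?case using Q by (simp add: diag_one unitary_def)
  next
    case (Suc n)
    then show ?case by (simp add: A conj_mul_conj[OF Q] diag_mul_diag)
  qed
qed

lemma trace_matrix_fun:
  assumes "diagonalizes Q l A"
  shows "Re (trace (matrix_fun f A)) = (\<Sum>k\<in>UNIV. f (l k))"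
proof -
  have Q: "unitary Q" using assms by (simp add: diagonalizes_def)
  show ?thesis by (simp add: matrix_fun_diagonalizes[OF assms] trace_conj[OF Q] trace_diag)
qed

lemma state_eigenvalues_le_1:
  assumes "\<And>k. 0 \<le> p k" "sum p UNIV = (1::real)"
  shows "p (k :: 'n::finite) \<le> 1"
  using member_le_sum[of k UNIV p] assms by simp

text \<open>For a polynomial the trace is a combination of traces of powers of
  \<open>\<rho>\<close>, which are continuous in the entries whatever eigenbasis is chosen.\<close>

lemma continuous_on_trace_polynomial_fun:
  assumes "real_polynomial_function g"
  shows "continuous_on {\<rho>. state \<rho>} (\<lambda>\<rho> :: ('n::finite) op. Re (trace (matrix_fun g \<rho>)))"
proof -
  obtain a n where g: "g = (\<lambda>x. \<Sum>i\<le>n. a i * x ^ i)"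
    using assms real_polynomial_function_iff_sum by blast
  have pow: "continuous_on S (\<lambda>\<rho> :: 'n op. ((**) \<rho> ^^ i) (mat 1))" for S i
  proof (induction i)
    case (Suc i)
    then show ?case by (simp, intro continuous_intros)
  qed simp
  have "continuous_on {\<rho>. state \<rho>} (\<lambda>\<rho> :: 'n op. \<Sum>i\<le>n. a i * Re (trace (((**) \<rho> ^^ i) (mat 1))))"
    by (intro continuous_intros pow)
  moreover have "(\<Sum>i\<le>n. a i * Re (trace (((**) \<rho> ^^ i) (mat 1)))) = Re (trace (matrix_fun g \<rho>))"
    if st: "state \<rho>" for \<rho> :: "'n op"
  proof -
    obtain Q p where D: "diagonalizes Q p \<rho>" using state_diagonalizable[OF st] by blast
    have Q: "unitary Q" using D by (simp add: diagonalizes_def)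
    have "(\<Sum>i\<le>n. a i * Re (trace (((**) \<rho> ^^ i) (mat 1)))) = (\<Sum>i\<le>n. \<Sum>k\<in>UNIV. a i * p k ^ i)"
      by (simp add: diagonalizes_power[OF D] trace_conj[OF Q] trace_diag sum_distrib_left
          del: of_real_power)
    also have "\<dots> = (\<Sum>k\<in>UNIV. g (p k))" unfolding g by (rule sum.swap)
    finally show ?thesis by (simp add: trace_matrix_fun[OF D])
  qed
  ultimately show ?thesis by (subst continuous_on_cong[OF refl]) auto
qed

text \<open>By Weierstrass, \<open>f\<close> is a uniform limit of polynomials on
  \<open>{0..1}\<close>, which contains the spectrum of every state. An error \<open>e\<close> in
  \<open>f\<close> changes the trace by at most \<open>CARD('n) * e\<close>, so the convergence is
  uniform on states and continuity passes to the limit.\<close>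

lemma continuous_on_trace_matrix_fun:
  fixes f :: "real \<Rightarrow> real"
  assumes f: "continuous_on {0..1} f"
  shows "continuous_on {\<rho>. state \<rho>} (\<lambda>\<rho> :: ('n::finite) op. Re (trace (matrix_fun f \<rho>)))"
proof -
  have "\<exists>g. real_polynomial_function g \<and> (\<forall>x\<in>{0..1}. \<bar>f x - g x\<bar> < 1 / real (Suc n))" for n
  proof -
    have "0 < 1 / real (Suc n)" by simp
    then show ?thesis
    proof (rule Stone_Weierstrass_real_polynomial_function[OF compact_Icc f])
      fix g assume "real_polynomial_function g"
        "\<And>x. x \<in> {0..1} \<Longrightarrow> \<bar>f x - g x\<bar> < 1 / real (Suc n)"
      then show ?thesis by (intro exI[of _ g] conjI ballI)
    qed
  qed
  then have "\<exists>g. \<forall>n. real_polynomial_function (g n) \<and> (\<forall>x\<in>{0..1}. \<bar>f x - g n x\<bar> < 1 / real (Suc n))"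
    by (intro choice allI)
  then obtain g where "\<forall>n. real_polynomial_function (g n)
      \<and> (\<forall>x\<in>{0..1}. \<bar>f x - g n x\<bar> < 1 / real (Suc n))" ..
  then have g: "\<And>n. real_polynomial_function (g n)"
    "\<And>n x. x \<in> {0..1} \<Longrightarrow> \<bar>f x - g n x\<bar> < 1 / real (Suc n)"
    by auto
  show ?thesis
  proof (rule uniform_limit_theorem)
    show "\<forall>\<^sub>F n in sequentially. continuous_on {\<rho> :: 'n op. state \<rho>}
        (\<lambda>\<rho>. Re (trace (matrix_fun (g n) \<rho>)))"
      using g(1) continuous_on_trace_polynomial_fun by (intro always_eventually) blast
    show "uniform_limit {\<rho> :: 'n op. state \<rho>} (\<lambda>n \<rho>. Re (trace (matrix_fun (g n) \<rho>)))
        (\<lambda>\<rho>. Re (trace (matrix_fun f \<rho>))) sequentially"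
    proof (rule uniform_limitI)
      fix e :: real assume e: "0 < e"
      have "(\<lambda>n. real CARD('n) * (1 / real (Suc n))) \<longlonglongrightarrow> 0"
        by real_asymp
      then have "\<forall>\<^sub>F n in sequentially. real CARD('n) * (1 / real (Suc n)) < e"
        using e by (rule order_tendstoD(2))
      then show "\<forall>\<^sub>F n in sequentially. \<forall>\<rho>\<in>{\<rho> :: 'n op. state \<rho>}.
          dist (Re (trace (matrix_fun (g n) \<rho>))) (Re (trace (matrix_fun f \<rho>))) < e"
      proof (eventually_elim, safe)
        fix n and \<rho> :: "'n op"
        assume n: "real CARD('n) * (1 / real (Suc n)) < e" and st: "state \<rho>"
        obtain Q p where D: "diagonalizes Q p \<rho>" "\<And>k. 0 \<le> p k" "sum p UNIV = 1"
          using state_diagonalizable[OF st] by blast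
        have "dist (Re (trace (matrix_fun (g n) \<rho>))) (Re (trace (matrix_fun f \<rho>)))
            = \<bar>\<Sum>k\<in>UNIV. f (p k) - g n (p k)\<bar>"
          by (simp add: trace_matrix_fun[OF D(1)] dist_real_def sum_subtractf abs_minus_commute)
        also have "\<dots> \<le> (\<Sum>k\<in>UNIV. \<bar>f (p k) - g n (p k)\<bar>)" by (rule sum_abs)
        also have "\<dots> \<le> (\<Sum>k\<in>(UNIV :: 'n set). 1 / real (Suc n))"
          using D state_eigenvalues_le_1[of p] by (intro sum_mono less_imp_le g(2)) auto
        also have "\<dots> < e" using n by simp
        finally show "dist (Re (trace (matrix_fun (g n) \<rho>))) (Re (trace (matrix_fun f \<rho>))) < e" .
      qed
    qed
  qed simp
qed

lemma continuous_on_x_log: "continuous_on {0..1} (\<lambda>x :: real. x * log 2 x)"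
proof -
  \<comment> \<open>The only delicate point is \<open>0\<close>, where the value is \<open>0\<close>
    and the right-hand limit agrees with it.\<close>
  have "((\<lambda>x :: real. x * log 2 x) \<longlongrightarrow> 0) (at_right 0)" by real_asymp
  then have 0: "continuous (at 0 within {0..1}) (\<lambda>x :: real. x * log 2 x)"
    by (simp add: continuous_within at_within_Icc_at_right)
  have "continuous (at x within {0..1}) (\<lambda>x :: real. x * log 2 x)" if "x \<in> {0..1}" for x
  proof (cases "x = 0")
    case False
    then have "x > 0" using that by simp
    then show ?thesis by (intro continuous_intros) auto
  qed (use 0 in simp)
  then show ?thesis by (simp add: continuous_on_eq_continuous_within)
qed

lemma continuous_on_entropy: "continuous_on {\<rho> :: ('n::finite) op. state \<rho>} entropy"
proof -
  \<comment> \<open>The factor \<open>\<rho>\<close> of the entropy is absorbed into the function,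
    since \<open>x * log 2 x\<close> is continuous at \<open>0\<close> while the logarithm alone is
    not.\<close>
  have "continuous_on {\<rho> :: 'n op. state \<rho>} (\<lambda>\<rho>. - Re (trace (matrix_fun (\<lambda>x. x * log 2 x) \<rho>)))"
    by (intro continuous_intros continuous_on_trace_matrix_fun continuous_on_x_log)
  moreover have "- Re (trace (matrix_fun (\<lambda>x. x * log 2 x) \<rho>)) = entropy \<rho>"
    if st: "state \<rho>" for \<rho> :: "'n op"
  proof -
    obtain Q p where D: "diagonalizes Q p \<rho>" using state_diagonalizable[OF st] by blast
    show ?thesis by (simp add: trace_matrix_fun[OF D] entropy_diagonalizes[OF D])
  qed
  ultimately show ?thesis by (subst continuous_on_cong[OF refl]) auto
qed

text \<open>The norm of nested vectors is the Hilbert-Schmidt norm. This turns trace identities into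
  norm bounds and into equalities of matrices.\<close>

lemma hermitian_trace_square:
  assumes "hermitian A"
  shows "trace (A ** A) = complex_of_real ((norm A)\<^sup>2)"
proof -
  have "(norm A)\<^sup>2 = (\<Sum>i\<in>UNIV. \<Sum>j\<in>UNIV. (cmod (A $ i $ j))\<^sup>2)"
    unfolding norm_square_vec[symmetric] by (simp add: norm_vec_def[of A] L2_set_def sum_nonneg)
  moreover have "A $ i $ j * A $ j $ i = A $ i $ j * cnj (A $ i $ j)" for i j
    using assms by (metis dagger_nth hermitian_def)
  then have "trace (A ** A) = (\<Sum>i\<in>UNIV. \<Sum>j\<in>UNIV. A $ i $ j * cnj (A $ i $ j))"
    by (simp only: trace_def matrix_matrix_mult_def vec_lambda_beta)
  ultimately show ?thesis by (simp add: complex_norm_square del: of_real_power)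
qed

text \<open>The squared norm of a state is the sum of its squared eigenvalues, hence at most
  \<open>1\<close>; positivity and unit trace are closed conditions on the entries.\<close>

lemma compact_states: "compact {\<rho> :: ('n::finite) op. state \<rho>}"
proof -
  have "bounded {\<rho> :: 'n op. state \<rho>}"
  proof (rule boundedI)
    fix \<rho> :: "'n op" assume "\<rho> \<in> {\<rho>. state \<rho>}"
    then have st: "state \<rho>" by simp
    obtain Q p where D: "diagonalizes Q p \<rho>" "\<And>k. 0 \<le> p k" "sum p UNIV = 1"
      using state_diagonalizable[OF st] by blast
    have Q: "unitary Q" and \<rho>: "\<rho> = Q ** diag p ** dagger Q"
      using D by (auto simp: diagonalizes_def)
    have "\<rho> ** \<rho> = Q ** diag (\<lambda>k. p k * p k) ** dagger Q"
      by (simp add: \<rho> conj_mul_conj[OF Q] diag_mul_diag)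
    then have "complex_of_real ((norm \<rho>)\<^sup>2) = complex_of_real (\<Sum>k\<in>UNIV. p k * p k)"
      using hermitian_trace_square[of \<rho>] st psd_hermitian[of \<rho>]
      by (simp add: state_def trace_conj[OF Q] trace_diag)
    then have "(norm \<rho>)\<^sup>2 = (\<Sum>k\<in>UNIV. p k * p k)" by (simp only: of_real_eq_iff)
    also have "\<dots> \<le> (\<Sum>k\<in>UNIV. p k * 1)"
      using D state_eigenvalues_le_1[of p] by (intro sum_mono mult_left_mono) auto
    finally have "(norm \<rho>)\<^sup>2 \<le> 1\<^sup>2" using D by simp
    then show "norm \<rho> \<le> 1" by (rule power2_le_imp_le) simp
  qed
  moreover have "closed {\<rho> :: 'n op. state \<rho>}"
  proof -
    have "{\<rho> :: 'n op. state \<rho>}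
        = (\<Inter>v. (\<lambda>\<rho>. cinner v (\<rho> *v v)) -` \<real>\<^sub>\<ge>\<^sub>0) \<inter> trace -` {1}"
      by (auto simp: state_def psd_def)
    moreover have "closed ((\<lambda>\<rho> :: 'n op. cinner v (\<rho> *v v)) -` \<real>\<^sub>\<ge>\<^sub>0)" for v
      unfolding cinner_def matrix_vector_mult_def
      by (intro closed_vimage closed_nonneg_Reals_complex continuous_intros)
    moreover have "closed ((trace :: 'n op \<Rightarrow> complex) -` {1})"
      unfolding trace_def by (intro closed_vimage closed_singleton continuous_intros)
    ultimately show ?thesis by (simp add: closed_INT closed_Int)
  qed
  ultimately show ?thesis by (simp add: compact_eq_bounded_closed)
qed

text \<open>Scalar matrices commute with \<open>P\<close>. As any unitary qualifies, the eigenbasis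
  of another state can serve the maximally mixed one as well.\<close>

lemma diagonalizes_maximally_mixed:
  assumes "unitary P"
  shows "diagonalizes P (\<lambda>_. 1 / real CARD('n)) (maximally_mixed :: ('n::finite) op)"
proof -
  have eq: "diag (\<lambda>_. 1 / real CARD('n)) = (maximally_mixed :: 'n op)"
    by (simp add: vec_eq_iff diag_def maximally_mixed_def mat_def scaleR_conv_of_real[where 'a = complex])
  have "P ** diag (\<lambda>_. c) = diag (\<lambda>_. c) ** P" for c
    by (simp add: vec_eq_iff mul_diag_nth diag_mul_nth)
  then have "P ** diag (\<lambda>_. c) ** dagger P = diag (\<lambda>_. c) ** (P ** dagger P)" for c
    by (simp add: matrix_mul_assoc)
  then show ?thesis using assms by (simp add: diagonalizes_def eq[symmetric] unitary_def)
qed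

lemma unitary_mat_1: "unitary (mat 1)"
  by (simp add: unitary_def)

lemma state_maximally_mixed: "state (maximally_mixed :: ('n::finite) op)"
  using diagonalizes_state_iff[OF diagonalizes_maximally_mixed[OF unitary_mat_1]] by simp

text \<open>Compactness supplies the maximiser that gives \<open>GREATEST\<close> its intended
  meaning.\<close>

lemma Greatest_attained:
  fixes f :: "'t::topological_space \<Rightarrow> real"
  assumes "compact S" "S \<noteq> {}" "continuous_on S f"
  shows "\<exists>x\<in>S. (GREATEST s. \<exists>x\<in>S. s = f x) = f x \<and> (\<forall>y\<in>S. f y \<le> f x)"
proof -
  obtain x where x: "x \<in> S" "\<forall>y\<in>S. f y \<le> f x"
    using continuous_attains_sup[OF assms] by blast
  then have "(GREATEST s. \<exists>x\<in>S. s = f x) = f x"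
    by (intro Greatest_equality) auto
  with x show ?thesis by blast
qed

lemma quantum_map_state:
  assumes \<Phi>: "quantum_map \<Phi>" and st: "state \<rho>"
  shows "state (\<Phi> \<rho>)"
proof -
  \<comment> \<open>Positivity is complete positivity with a single block.\<close>
  have "block_psd 1 (\<lambda>_ _. \<rho>)" using st by (simp add: block_psd_def state_def psd_def)
  then have *: "block_psd 1 (\<lambda>_ _. \<Phi> \<rho>)"
    using \<Phi> unfolding quantum_map_def completely_positive_def by blast
  have "cinner v (\<Phi> \<rho> *v v) \<in> \<real>\<^sub>\<ge>\<^sub>0" for v
    using *[unfolded block_psd_def, rule_format, of "\<lambda>_. v"] by simp
  then show ?thesis
    using \<Phi> st by (simp add: state_def psd_def quantum_map_def trace_preserving_def)
qed

lemma scaleR_map_matrix: "r *\<^sub>R X = map_matrix ((*) (complex_of_real r)) X"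
  by (simp add: vec_eq_iff scaleR_conv_of_real[where 'a = complex])

lemma quantum_map_continuous_on:
  fixes \<Phi> :: "('a::finite) op \<Rightarrow> ('b::finite) op"
  assumes "quantum_map \<Phi>"
  shows "continuous_on S \<Phi>"
proof -
  have "linear \<Phi>"
    using assms
    by (intro linearI) (simp_all add: quantum_map_def complex_linear_def scaleR_map_matrix)
  then show ?thesis by (simp add: linear_continuous_on linear_conv_bounded_linear)
qed

lemma continuous_on_entropy_quantum_map:
  assumes "quantum_map \<Phi>"
  shows "continuous_on {\<rho>. state \<rho>} (\<lambda>\<rho>. entropy (\<Phi> \<rho>))"
  using quantum_map_state[OF assms]
  by (intro continuous_on_compose2[OF continuous_on_entropy quantum_map_continuous_on[OF assms]]) auto

lemma entropy_production_attained:
  fixes \<Phi> :: "('a::finite) op \<Rightarrow> ('b::finite) op"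
  assumes "quantum_map \<Phi>"
  obtains \<rho> where "state \<rho>" "entropy_production \<Phi> = entropy (\<Phi> \<rho>) - entropy \<rho>"
proof -
  let ?S = "{\<rho> :: 'a op. state \<rho>}"
  have "continuous_on ?S (\<lambda>\<rho>. entropy (\<Phi> \<rho>) - entropy \<rho>)"
    by (intro continuous_on_diff continuous_on_entropy continuous_on_entropy_quantum_map assms)
  moreover have "?S \<noteq> {}" using state_maximally_mixed by blast
  ultimately have "\<exists>\<rho>\<in>?S. (GREATEST s. \<exists>\<rho>\<in>?S. s = entropy (\<Phi> \<rho>) - entropy \<rho>)
      = entropy (\<Phi> \<rho>) - entropy \<rho>"
    using Greatest_attained[OF compact_states] by blast
  then show thesis using that by (auto simp: entropy_production_def)
qed

section \<open>Marginals and mutual information for product inputs\<close>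

lemma trace_snd_tensor: "trace B = 1 \<Longrightarrow> trace_snd (tensor A B) = A"
  by (simp add: vec_eq_iff trace_snd_def tensor_def trace_def flip: sum_distrib_left)

lemma trace_fst_tensor: "trace A = 1 \<Longrightarrow> trace_fst (tensor A B) = B"
  by (simp add: vec_eq_iff trace_fst_def tensor_def trace_def flip: sum_distrib_right)

text \<open>A product input has marginals \<open>\<rho>1\<close> and \<open>\<rho>2\<close>, so the
  conditions on \<Psi> identify the output marginals. Every term becomes the entropy of a quantum
  map's output, whose continuity is known.\<close>

lemma mutual_information_marginals:
  assumes "trace_snd \<circ> \<Psi> = \<Psi>\<^sub>1 \<circ> trace_snd" "trace_fst \<circ> \<Psi> = \<Psi>\<^sub>2 \<circ> trace_fst"
    and "state \<rho>1" "state \<rho>2"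
  shows "mutual_information (\<Psi> (tensor \<rho>1 \<rho>2))
    = entropy (\<Psi>\<^sub>1 \<rho>1) + entropy (\<Psi>\<^sub>2 \<rho>2) - entropy (\<Psi> (tensor \<rho>1 \<rho>2))"
  using assms(1,2)[THEN fun_cong, of "tensor \<rho>1 \<rho>2"] assms(3,4)
  by (simp add: mutual_information_def state_def trace_snd_tensor trace_fst_tensor)

lemma mutual_information_le_max_product_correlation:
  fixes \<Psi> :: "('a1::finite \<times> 'a2::finite) op \<Rightarrow> ('a1 \<times> 'a2) op"
  assumes q: "quantum_map \<Psi>\<^sub>1" "quantum_map \<Psi>\<^sub>2" "quantum_map \<Psi>"
    and m: "trace_snd \<circ> \<Psi> = \<Psi>\<^sub>1 \<circ> trace_snd" "trace_fst \<circ> \<Psi> = \<Psi>\<^sub>2 \<circ> trace_fst"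
    and st: "state \<rho>1" "state \<rho>2"
  shows "mutual_information (\<Psi> (tensor \<rho>1 \<rho>2)) \<le> max_product_correlation \<Psi>"
proof -
  let ?S = "{\<rho> :: 'a1 op. state \<rho>} \<times> {\<rho> :: 'a2 op. state \<rho>}"
  let ?f = "\<lambda>x. mutual_information (\<Psi> (tensor (fst x) (snd x)))"
  have cont: "continuous_on ?S ?f"
  proof -
    have "continuous_on ?S (\<lambda>x. tensor (fst x) (snd x))"
      unfolding tensor_def by (intro continuous_intros)
    then have "continuous_on ?S (\<lambda>x. entropy (\<Psi>\<^sub>1 (fst x)) + entropy (\<Psi>\<^sub>2 (snd x))
        - entropy (\<Psi> (tensor (fst x) (snd x))))"
      using state_tensor
      by (intro continuous_on_add continuous_on_diff
          continuous_on_compose2[OF continuous_on_entropy_quantum_map[OF q(1)]]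
          continuous_on_compose2[OF continuous_on_entropy_quantum_map[OF q(2)]]
          continuous_on_compose2[OF continuous_on_entropy_quantum_map[OF q(3)]]
          continuous_intros) auto
    then show ?thesis
      by (subst continuous_on_cong[OF refl mutual_information_marginals[OF m]]) auto
  qed
  have "compact ?S" by (intro compact_Times compact_states)
  moreover have "?S \<noteq> {}" using st by blast
  ultimately obtain x where x: "(GREATEST s. \<exists>x\<in>?S. s = ?f x) = ?f x" "\<forall>y\<in>?S. ?f y \<le> ?f x"
    using Greatest_attained[OF _ _ cont] by blast
  have "(\<lambda>s. \<exists>x\<in>?S. s = ?f x)
      = (\<lambda>s. \<exists>\<rho>1 \<rho>2. state \<rho>1 \<and> state \<rho>2 \<and> s = mutual_information (\<Psi> (tensor \<rho>1 \<rho>2)))"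
    by (auto simp: fun_eq_iff)
  then have "max_product_correlation \<Psi> = ?f x"
    using x(1) by (simp only: max_product_correlation_def)
  with x(2) st show ?thesis by auto
qed

section \<open>Catalytic implementations\<close>

lemma unitary_column_norm:
  assumes "unitary W"
  shows "(\<Sum>i\<in>UNIV. (cmod (W $ i $ j))\<^sup>2) = 1"
proof -
  have "(dagger W ** W) $ j $ j = mat 1 $ j $ j" using assms by (simp add: unitary_def)
  then have "complex_of_real (\<Sum>i\<in>UNIV. (cmod (W $ i $ j))\<^sup>2) = 1"
    by (simp add: matrix_matrix_mult_def mat_def complex_norm_square mult.commute del: of_real_power)
  then show ?thesis by (simp only: of_real_eq_1_iff)
qed

section \<open>Conjugation by operators local to the catalyst\<close>

lemma dagger_diff: "dagger (A - B) = dagger A - dagger B"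
  by (simp add: vec_eq_iff)

lemma matrix_diff_mul: "((A :: ('n::finite) op) - B) ** C = A ** C - B ** C"
  by (simp add: vec_eq_iff matrix_matrix_mult_def left_diff_distrib sum_subtractf)

lemma matrix_mul_diff: "(A :: ('n::finite) op) ** (B - C) = A ** B - A ** C"
  by (simp add: vec_eq_iff matrix_matrix_mult_def right_diff_distrib sum_subtractf)

lemma sum_pair_delta:
  fixes f :: "'a::finite \<times> 'b::finite \<Rightarrow> complex"
  shows "(\<Sum>p\<in>UNIV. (if i = fst p then 1 else 0) * f p) = (\<Sum>m\<in>UNIV. f (i, m))"
proof -
  have "(\<Sum>m\<in>UNIV. (if i = a then 1 else 0) * f (a, m)) = (if a = i then \<Sum>m\<in>UNIV. f (i, m) else 0)"
    for a by simp
  then show ?thesis by (simp add: sum_UNIV_pair)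
qed

lemma tensor_mat_1_conj_nth:
  fixes X :: "('a::finite \<times> 'b::finite) op"
  shows "(tensor (mat 1) B ** X ** dagger (tensor (mat 1) B)) $ (i, k) $ (j, l)
    = (\<Sum>n\<in>UNIV. \<Sum>m\<in>UNIV. B $ k $ m * X $ (i, m) $ (j, n) * cnj (B $ l $ n))"
proof -
  have left: "(tensor (mat 1) B ** X) $ (i, k) $ q = (\<Sum>m\<in>UNIV. B $ k $ m * X $ (i, m) $ q)" for q
    using sum_pair_delta[of i "\<lambda>p. B $ k $ snd p * X $ p $ q"]
    by (simp add: matrix_matrix_mult_def tensor_def mat_def mult.assoc)
  have "(tensor (mat 1) B ** X ** dagger (tensor (mat 1) B)) $ (i, k) $ (j, l)
      = (\<Sum>p\<in>UNIV. (if j = fst p then 1 else 0) *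
          ((tensor (mat 1) B ** X) $ (i, k) $ p * cnj (B $ l $ snd p)))"
    by (subst matrix_matrix_mult_def) (auto simp: tensor_def mat_def intro!: sum.cong)
  also have "\<dots> = (\<Sum>n\<in>UNIV. (tensor (mat 1) B ** X) $ (i, k) $ (j, n) * cnj (B $ l $ n))"
    by (simp add: sum_pair_delta)
  finally show ?thesis by (simp add: left sum_distrib_right)
qed

lemma trace_fst_conj_tensor:
  "trace_fst (tensor (mat 1) B ** X ** dagger (tensor (mat 1) B)) = B ** trace_fst X ** dagger B"
proof -
  have "trace_fst (tensor (mat 1) B ** X ** dagger (tensor (mat 1) B)) $ i $ j
      = (B ** trace_fst X ** dagger B) $ i $ j" for i j
  proof -
    let ?g = "\<lambda>k n m. B $ i $ m * X $ (k, m) $ (k, n) * cnj (B $ j $ n)"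
    have "trace_fst (tensor (mat 1) B ** X ** dagger (tensor (mat 1) B)) $ i $ j
        = (\<Sum>k\<in>UNIV. \<Sum>n\<in>UNIV. \<Sum>m\<in>UNIV. ?g k n m)"
      by (simp add: trace_fst_def tensor_mat_1_conj_nth)
    also have "\<dots> = (\<Sum>n\<in>UNIV. \<Sum>k\<in>UNIV. \<Sum>m\<in>UNIV. ?g k n m)"
      by (rule sum.swap)
    also have "\<dots> = (\<Sum>n\<in>UNIV. \<Sum>m\<in>UNIV. \<Sum>k\<in>UNIV. ?g k n m)"
      by (intro sum.cong refl sum.swap)
    also have "\<dots> = (B ** trace_fst X ** dagger B) $ i $ j"
      by (simp add: trace_fst_def matrix_matrix_mult_def sum_distrib_left sum_distrib_right)
    finally show ?thesis .
  qed
  then show ?thesis by (simp add: vec_eq_iff)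
qed

text \<open>A unitary on the discarded factor is invisible after tracing it out. So the final change
  of basis on the catalyst leaves the output of the map unchanged.\<close>

lemma trace_snd_conj_tensor:
  fixes X :: "('a::finite \<times> 'b::finite) op"
  assumes R: "unitary R"
  shows "trace_snd (tensor (mat 1) R ** X ** dagger (tensor (mat 1) R)) = trace_snd X"
proof -
  have orth: "(\<Sum>k\<in>UNIV. cnj (R $ k $ n) * R $ k $ m) = (if n = m then 1 else 0)" for m n
  proof -
    have "(dagger R ** R) $ n $ m = mat 1 $ n $ m" using R by (simp add: unitary_def)
    then show ?thesis by (simp add: matrix_matrix_mult_def mat_def)
  qed
  have "trace_snd (tensor (mat 1) R ** X ** dagger (tensor (mat 1) R)) $ i $ j
      = trace_snd X $ i $ j" for i j
  proof -
    let ?g = "\<lambda>k n m. R $ k $ m * X $ (i, m) $ (j, n) * cnj (R $ k $ n)"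
    have "trace_snd (tensor (mat 1) R ** X ** dagger (tensor (mat 1) R)) $ i $ j
        = (\<Sum>k\<in>UNIV. \<Sum>n\<in>UNIV. \<Sum>m\<in>UNIV. ?g k n m)"
      by (simp add: trace_snd_def tensor_mat_1_conj_nth)
    also have "\<dots> = (\<Sum>n\<in>UNIV. \<Sum>k\<in>UNIV. \<Sum>m\<in>UNIV. ?g k n m)"
      by (rule sum.swap)
    also have "\<dots> = (\<Sum>n\<in>UNIV. \<Sum>m\<in>UNIV. \<Sum>k\<in>UNIV. ?g k n m)"
      by (intro sum.cong refl sum.swap)
    also have "\<dots> = (\<Sum>n\<in>UNIV. \<Sum>m\<in>UNIV. (\<Sum>k\<in>UNIV. cnj (R $ k $ n) * R $ k $ m) * X $ (i, m) $ (j, n))"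
      by (simp add: sum_distrib_left sum_distrib_right mult_ac)
    also have "\<dots> = trace_snd X $ i $ j"
      unfolding orth by (simp add: trace_snd_def if_distrib[of "\<lambda>x. x * _"] cong: if_cong)
    finally show ?thesis .
  qed
  then show ?thesis by (simp add: vec_eq_iff)
qed

text \<open>
  Equality case of Cauchy--Schwarz for the Hilbert--Schmidt inner product of \<open>D\<close> and
  \<open>X = W ** D ** dagger W\<close>, which have the same norm.
\<close>

lemma catalysis_block_diagonal:
  fixes W :: "('a::finite \<times> 'b::finite) op"
  assumes W: "unitary W"
    and tr: "trace_fst (W ** diag (\<lambda>x. 1 / real CARD('a) * s (snd x)) ** dagger W) = diag s"
    and ne: "s m \<noteq> s n"
  shows "W $ (a, n) $ (k, m) = 0"
proof -
  let ?d = "real CARD('a)"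
  let ?D = "diag (\<lambda>x. 1 / ?d * s (snd x)) :: ('a \<times> 'b) op"
  define X where "X = W ** ?D ** dagger W"
  have hX: "hermitian X" unfolding X_def by (rule hermitian_conj_diag)
  have hD: "hermitian ?D" by (simp add: hermitian_def)
  let ?q = "complex_of_real (\<Sum>m\<in>UNIV. s m * s m / ?d)"
  have DD: "trace (?D ** ?D) = ?q"
    by (simp add: diag_mul_diag trace_diag sum_UNIV_pair del: of_real_sum) (simp add: sum_distrib_left)
  have XX: "trace (X ** X) = ?q"
    unfolding X_def conj_mul_conj[OF W] trace_conj[OF W] by (rule DD)
  \<comment> \<open>\<open>?D\<close> is scalar on the system factor, so the pairing sees only the
    reduced operator \<open>trace_fst X\<close>, which \<open>tr\<close> gives.\<close>
  have XD: "trace (X ** ?D) = ?q"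
  proof -
    have "trace (X ** ?D) = (\<Sum>i\<in>UNIV. \<Sum>m\<in>UNIV. X $ (i, m) $ (i, m) * complex_of_real (s m / ?d))"
      by (simp add: trace_def mul_diag_nth sum_UNIV_pair)
    also have "\<dots> = (\<Sum>m\<in>UNIV. \<Sum>i\<in>UNIV. X $ (i, m) $ (i, m) * complex_of_real (s m / ?d))"
      by (rule sum.swap)
    also have "\<dots> = (\<Sum>m\<in>UNIV. trace_fst X $ m $ m * complex_of_real (s m / ?d))"
      by (simp add: trace_fst_def sum_distrib_right del: of_real_divide)
    also have "\<dots> = ?q" unfolding X_def tr by (simp add: diag_def)
    finally show ?thesis .
  qed
  have "hermitian (X - ?D)" using hX hD by (simp add: hermitian_def dagger_diff)
  then have "complex_of_real ((norm (X - ?D))\<^sup>2) = trace ((X - ?D) ** (X - ?D))"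
    by (simp only: hermitian_trace_square)
  also have "(X - ?D) ** (X - ?D) = (X ** X - X ** ?D) - (?D ** X - ?D ** ?D)"
    by (simp add: matrix_diff_mul matrix_mul_diff)
  \<comment> \<open>All four traces equal \<open>?q\<close>, so \<open>X\<close> and
    \<open>?D\<close> have distance zero.\<close>
  also have "trace \<dots> = 0"
    by (simp only: trace_sub XX XD DD trace_mul_sym[of ?D X] diff_self)
  finally have "X = ?D" by simp
  then have "W ** ?D = ?D ** W"
    using W unfolding X_def unitary_def by (metis matrix_mul_assoc matrix_mul_rid)
  \<comment> \<open>Commutation compares this entry of \<open>W\<close> scaled by \<open>s m\<close>
    with the same entry scaled by \<open>s n\<close>, so distinct eigenvalues force it to be
    zero.\<close>
  then have "(W ** ?D) $ (a, n) $ (k, m) = (?D ** W) $ (a, n) $ (k, m)" by simp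
  then show ?thesis using ne by (simp add: mul_diag_nth diag_mul_nth)
qed

lemma entropy_block_diagonal_le:
  fixes W :: "('a::finite \<times> 'b::finite) op"
  assumes W: "unitary W"
    and block: "\<And>a n k m. s m \<noteq> s n \<Longrightarrow> W $ (a, n) $ (k, m) = 0"
    and p: "\<And>k. 0 \<le> p k" "sum p UNIV = 1" and s: "\<And>m. 0 \<le> s m" "sum s UNIV = 1"
    and \<omega>: "\<omega> = trace_snd (W ** diag (\<lambda>x. p (fst x) * s (snd x)) ** dagger W)"
    and st: "state \<omega>"
  shows "entropy \<omega> \<le> - (\<Sum>k\<in>UNIV. p k * log 2 (p k))
    - (\<Sum>m\<in>UNIV. s m * log 2 (s m / real (card {n. s n = s m})))"
proof -
  define r where "r m = real (card {n. s n = s m})" for m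
  have r: "0 < r m" for m unfolding r_def by (auto simp: card_gt_0_iff)
  \<comment> \<open>The index \<open>(k, m, n)\<close> records the input eigenvectors
    \<open>k\<close>, \<open>m\<close> and the output basis vector \<open>n\<close> of the catalyst
    over which the trace is taken.\<close>
  define w where "w = (\<lambda>(k, m, n). \<chi> a. complex_of_real (sqrt (p k * s m)) * W $ (a, n) $ (k, m))"
  \<comment> \<open>The reference distribution: \<open>k\<close> and \<open>m\<close> are drawn from
    \<open>p\<close> and \<open>s\<close>, and \<open>n\<close> uniformly from the
    \<open>r m\<close> indices with the same eigenvalue as \<open>m\<close>.\<close>
  define y where "y = (\<lambda>(k, m, n). if s n = s m then p k * (s m / r m) else 0)"
  define t where "t k m n = (\<Sum>a\<in>UNIV. (cmod (W $ (a, n) $ (k, m)))\<^sup>2)" for k m n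
  have sum3: "(\<Sum>j\<in>UNIV. f j) = (\<Sum>k\<in>UNIV. \<Sum>m\<in>UNIV. \<Sum>n\<in>UNIV. f (k, m, n))"
    for f :: "'a \<times> 'b \<times> 'b \<Rightarrow> 'c::comm_monoid_add"
    by (simp add: sum_UNIV_pair)
  have out: "\<omega> = (\<chi> a b. \<Sum>j\<in>UNIV. w j $ a * cnj (w j $ b))"
  proof -
    have "\<omega> $ a $ b = (\<Sum>j\<in>UNIV. w j $ a * cnj (w j $ b))" for a b
    proof -
      have "\<omega> $ a $ b = (\<Sum>n\<in>UNIV. \<Sum>k\<in>UNIV. \<Sum>m\<in>UNIV. w (k, m, n) $ a * cnj (w (k, m, n) $ b))"
      proof -
        have "complex_of_real (p k) * complex_of_real (s m)
            = complex_of_real (sqrt (p k * s m)) * complex_of_real (sqrt (p k * s m))" for k m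
          using p s by (simp flip: of_real_mult)
        then show ?thesis
          by (simp add: \<omega> trace_snd_def conj_diag_nth sum_UNIV_pair w_def mult_ac)
      qed
      also have "\<dots> = (\<Sum>k\<in>UNIV. \<Sum>n\<in>UNIV. \<Sum>m\<in>UNIV. w (k, m, n) $ a * cnj (w (k, m, n) $ b))"
        by (rule sum.swap)
      also have "\<dots> = (\<Sum>k\<in>UNIV. \<Sum>m\<in>UNIV. \<Sum>n\<in>UNIV. w (k, m, n) $ a * cnj (w (k, m, n) $ b))"
        by (intro sum.cong refl sum.swap)
      finally show ?thesis by (simp add: sum3)
    qed
    then show ?thesis by (simp add: vec_eq_iff)
  qed
  have y0: "0 \<le> y j" for j using p(1) s(1) r by (auto simp: y_def less_imp_le split: prod.split)
  have y1: "sum y UNIV = 1"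
  proof -
    have "(\<Sum>n\<in>UNIV. y (k, m, n)) = p k * s m" for k m
    proof -
      have "(\<Sum>n\<in>UNIV. y (k, m, n)) = r m * (p k * (s m / r m))"
        by (simp add: y_def r_def sum.If_cases)
      then show ?thesis using r[of m] by simp
    qed
    then show ?thesis by (simp add: sum3 flip: sum_product) (simp add: p s)
  qed
  have norm_w: "(norm (w (k, m, n)))\<^sup>2 = p k * s m * t k m n" for k m n
    using p(1)[of k] s(1)[of m]
    by (simp add: norm_square_vec w_def t_def norm_mult power_mult_distrib sum_distrib_left)
  \<comment> \<open>Here the block structure enters: a nonzero \<open>w j\<close> stays within one
    eigenspace of the catalyst, exactly where \<open>y\<close> is allowed to be positive.\<close>
  have pos: "0 < y j" if w: "w j \<noteq> 0" for j
  proof -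
    obtain k m n where j: "j = (k, m, n)" by (cases j) auto
    obtain a where "w j $ a \<noteq> 0" using w by (auto simp: vec_eq_iff)
    then have "p k * s m \<noteq> 0" "W $ (a, n) $ (k, m) \<noteq> 0" by (auto simp: j w_def)
    moreover from this have "s n = s m" using block by metis
    ultimately show ?thesis using p(1)[of k] s(1)[of m] r[of m]
      by (simp add: y_def j less_le)
  qed
  \<comment> \<open>Columns of \<open>W\<close> are unit vectors, so summing over \<open>n\<close>
    removes \<open>W\<close> from the bound.\<close>
  have t1: "(\<Sum>n\<in>UNIV. t k m n) = 1" for k m
    unfolding t_def using unitary_column_norm[OF W, of "(k, m)"]
    by (subst sum.swap) (simp add: sum_UNIV_pair)
  have "(norm (w (k, m, n)))\<^sup>2 * log 2 (y (k, m, n))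
      = (p k * log 2 (p k) * s m + p k * (s m * log 2 (s m / r m))) * t k m n" for k m n
  \<comment> \<open>In the degenerate cases both sides are zero: a factor \<open>p k\<close> or
    \<open>s m\<close> vanishes, or \<open>block\<close> makes \<open>t k m n\<close>
    vanish.\<close>
  proof (cases "p k = 0 \<or> s m = 0 \<or> s n \<noteq> s m")
    case True
    then show ?thesis using block[of m n] by (auto simp: norm_w t_def)
  next
    case False
    then have "log 2 (y (k, m, n)) = log 2 (p k) + log 2 (s m / r m)"
      using p(1)[of k] s(1)[of m] r[of m] by (simp add: y_def log_mult log_divide)
    then show ?thesis by (simp add: norm_w algebra_simps)
  qed
  then have "(\<Sum>j\<in>UNIV. (norm (w j))\<^sup>2 * log 2 (y j))
      = (\<Sum>k\<in>UNIV. \<Sum>m\<in>UNIV. p k * log 2 (p k) * s m + p k * (s m * log 2 (s m / r m)))"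
    by (simp add: sum3 t1 flip: sum_distrib_left)
  also have "\<dots> = (\<Sum>k\<in>UNIV. p k * log 2 (p k)) * sum s UNIV
      + sum p UNIV * (\<Sum>m\<in>UNIV. s m * log 2 (s m / r m))"
    by (simp add: sum.distrib sum_product)
  finally have "(\<Sum>j\<in>UNIV. (norm (w j))\<^sup>2 * log 2 (y j))
      = (\<Sum>k\<in>UNIV. p k * log 2 (p k)) + (\<Sum>m\<in>UNIV. s m * log 2 (s m / r m))"
    using p s by simp
  then show ?thesis
    using entropy_outer_sum_le[OF _ st out, of y] y0 y1 pos by (simp add: r_def)
qed

theorem catalytic_entropy_bound:
  fixes \<Phi> :: "('a::finite) op \<Rightarrow> 'a op" and \<sigma> :: "('b::finite) op"
  assumes \<Phi>: "quantum_map \<Phi>" and cat: "implemented_catalytically \<Phi> \<sigma>"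
    and \<sigma>: "state \<sigma>" and \<rho>: "state \<rho>"
  shows "entropy (\<Phi> \<rho>) \<le> entropy \<rho> + catalytic_entropy \<sigma>"
proof -
  obtain U V where U: "unitary U" and V: "unitary V"
    and UV: "\<And>\<tau>. state \<tau> \<Longrightarrow> trace_snd (U ** tensor \<tau> \<sigma> ** dagger U) = \<Phi> \<tau>"
      "\<And>\<tau>. state \<tau> \<Longrightarrow> trace_fst (U ** tensor \<tau> \<sigma> ** dagger U) = V ** \<sigma> ** dagger V"
    using cat unfolding implemented_catalytically_def by blast
  obtain P p where P: "diagonalizes P p \<rho>" "\<And>k. 0 \<le> p k" "sum p UNIV = 1"
    using state_diagonalizable[OF \<rho>] by blast
  obtain Q s where Q: "diagonalizes Q s \<sigma>" "\<And>k. 0 \<le> s k" "sum s UNIV = 1"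
    using state_diagonalizable[OF \<sigma>] by blast
  have uP: "unitary P" and uQ: "unitary Q" and \<sigma>Q: "\<sigma> = Q ** diag s ** dagger Q"
    using P Q by (auto simp: diagonalizes_def)
  \<comment> \<open>Undoes \<open>V\<close> and passes to the eigenbasis of \<sigma>, so that the
    returned catalyst becomes \<open>diag s\<close>.\<close>
  define R where "R = dagger (V ** Q)"
  have uR: "unitary R" unfolding R_def by (intro unitary_dagger unitary_mul V uQ)
  \<comment> \<open>\<open>U\<close> written with inputs in the eigenbases of \<rho> and \<sigma>;
    on the output only the catalyst is rotated, by \<open>R\<close>.\<close>
  define W where "W = tensor (mat 1) R ** U ** tensor P Q"
  have uW: "unitary W"
    unfolding W_def by (intro unitary_mul unitary_tensor unitary_mat_1 uR U uP uQ)
  have conj: "W ** diag (\<lambda>x. l (fst x) * s (snd x)) ** dagger W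
      = tensor (mat 1) R ** (U ** tensor \<tau> \<sigma> ** dagger U) ** dagger (tensor (mat 1) R)"
    if "diagonalizes P l \<tau>" for l \<tau>
    using diagonalizes_tensor[OF that Q(1)]
    by (simp add: W_def diagonalizes_def dagger_mul matrix_mul_assoc)
  have "R ** (V ** \<sigma> ** dagger V) ** dagger R = diag s"
  proof -
    have RV: "R ** (V ** Q) = mat 1" "dagger (V ** Q) ** (V ** Q) = mat 1"
      using uR unitary_mul[OF V uQ] by (simp_all add: R_def unitary_def)
    have "V ** \<sigma> ** dagger V = (V ** Q) ** diag s ** dagger (V ** Q)"
      by (simp add: \<sigma>Q dagger_mul matrix_mul_assoc)
    then have "R ** (V ** \<sigma> ** dagger V) ** dagger R
        = (R ** (V ** Q)) ** diag s ** (dagger (V ** Q) ** dagger R)"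
      by (simp add: matrix_mul_assoc)
    also have "dagger (V ** Q) ** dagger R = mat 1"
      using RV(2) by (simp add: R_def)
    finally show ?thesis by (simp add: RV)
  qed
  \<comment> \<open>The catalytic condition at the maximally mixed state. It is diagonal in the
    basis \<open>P\<close> too, so the same \<open>W\<close> serves for it and for \<rho>.\<close>
  then have fst: "trace_fst (W ** diag (\<lambda>x. 1 / real CARD('a) * s (snd x)) ** dagger W) = diag s"
    using conj[OF diagonalizes_maximally_mixed[OF uP]]
    by (simp add: trace_fst_conj_tensor UV(2)[OF state_maximally_mixed])
  have snd: "\<Phi> \<rho> = trace_snd (W ** diag (\<lambda>x. p (fst x) * s (snd x)) ** dagger W)"
    by (simp only: conj[OF P(1)] trace_snd_conj_tensor[OF uR] UV(1)[OF \<rho>])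
  show ?thesis
    using entropy_block_diagonal_le[OF uW catalysis_block_diagonal[OF uW fst] P(2,3) Q(2,3) snd
        quantum_map_state[OF \<Phi> \<rho>]]
    by (simp add: entropy_diagonalizes[OF P(1)] catalytic_entropy_diagonalizes[OF Q(1)])
qed

theorem theorem13:
  fixes \<sigma> :: "('b::finite) op"
    and \<Psi>\<^sub>1 :: "('a1::finite) op \<Rightarrow> 'a1 op"
    and \<Psi>\<^sub>2 :: "('a2::finite) op \<Rightarrow> 'a2 op"
    and \<Psi> :: "('a1 \<times> 'a2) op \<Rightarrow> ('a1 \<times> 'a2) op"
  assumes "state \<sigma>"
    and "unital_map \<Psi>\<^sub>1"
    and "unital_map \<Psi>\<^sub>2"
    and "quantum_map \<Psi>"
    and "implemented_catalytically \<Psi> \<sigma>"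
    and "trace_snd \<circ> \<Psi> = \<Psi>\<^sub>1 \<circ> trace_snd"
    and "trace_fst \<circ> \<Psi> = \<Psi>\<^sub>2 \<circ> trace_fst"
  shows "max_product_correlation \<Psi>
           \<ge> entropy_production \<Psi>\<^sub>1 + entropy_production \<Psi>\<^sub>2 - catalytic_entropy \<sigma>"
proof -
  have q: "quantum_map \<Psi>\<^sub>1" "quantum_map \<Psi>\<^sub>2" using assms(2,3) by (auto simp: unital_map_def)
  obtain \<rho>1 where 1: "state \<rho>1" "entropy_production \<Psi>\<^sub>1 = entropy (\<Psi>\<^sub>1 \<rho>1) - entropy \<rho>1"
    using entropy_production_attained[OF q(1)] by blast
  obtain \<rho>2 where 2: "state \<rho>2" "entropy_production \<Psi>\<^sub>2 = entropy (\<Psi>\<^sub>2 \<rho>2) - entropy \<rho>2"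
    using entropy_production_attained[OF q(2)] by blast
  \<comment> \<open>The catalytic bound at the product of the two optimal inputs, where the input
    entropies add. Subtracting it from the output marginal entropies leaves the two productions
    minus the catalytic entropy.\<close>
  have "entropy (\<Psi> (tensor \<rho>1 \<rho>2)) \<le> entropy \<rho>1 + entropy \<rho>2 + catalytic_entropy \<sigma>"
    using catalytic_entropy_bound[OF assms(4,5,1) state_tensor[OF 1(1) 2(1)]]
    by (simp add: entropy_tensor[OF 1(1) 2(1)])
  moreover have "mutual_information (\<Psi> (tensor \<rho>1 \<rho>2)) \<le> max_product_correlation \<Psi>"
    by (rule mutual_information_le_max_product_correlation[OF q assms(4,6,7) 1(1) 2(1)])
  ultimately show ?thesis
    by (simp add: mutual_information_marginals[OF assms(6,7) 1(1) 2(1)] 1(2) 2(2))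
qed

end
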